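(* (Monodromy space of type $(1/2,-,1)$, Painlevé III($D_7$).) Let $AnalyticData$ be the affine variety of pairs $(L,e)$ with $L=\begin{pmatrix}\ell_1&\ell_2\\ \ell_3&\ell_4\end{pmatrix}\in SL_2(\mathbb{C})$ and $e\in\mathbb{C}$ such that the $(1,1)$-entry $\alpha$ of $$top_\infty:=L\begin{pmatrix}0&1\\ -1&-e\end{pmatrix}L^{-1}$$ is non-zero. Let $\mu\in\mathbb{G}_m$ act by giving $\ell_1,\ell_2,\ell_3,\ell_4,e$ the weights $-1,-1,1,1,0$, and let $\mathcal{R}=AnalyticData/\!/\mathbb{G}_m$ with the morphism $\alpha:\mathcal{R}\to\mathcal{P}=\mathbb{C}^*$. With $x_1=\ell_1\ell_3$, $x_2=\ell_2\ell_3$, $x_3=-e$, the coordinate ring of $\mathcal{R}$ is $$\mathbb{C}[\alpha,\alpha^{-1},x_1,x_2,x_3]/(x_1x_2x_3+x_1^2+x_2^2+\alpha x_1+x_2),$$ and all fibres of $\mathcal{R}\to\mathcal{P}$ are non-singular affine cubic surfaces.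
   Context: $X/\!/G$ denotes the categorical quotient $\mathrm{Spec}(\mathcal{O}(X)^G)$ of an affine variety by a reductive group. Origin of the data: rank-two differential modules on $\mathbb{P}^1$ (trivial determinant), singular only at $0$ (ramified, Katz invariant $1/2$) and $\infty$ (unramified, Katz invariant $1$). The topological monodromy at $0$ is $top_0=\begin{pmatrix}0&-1\\ 1&0\end{pmatrix}\begin{pmatrix}1&0\\ e&1\end{pmatrix}=\begin{pmatrix}-e&-1\\ 1&0\end{pmatrix}$, $L$ is the link, the relation is $top_0\cdot L^{-1}top_\infty L=1$, and $\alpha$ is the eigenvalue of the formal monodromy at $\infty$. *)

theory Defs
  imports
    "HOL-Analysis.Analysis"
    "HOL-Library.Poly_Mapping"
    "HOL-Algebra.QuotRing"
    "HOL-Algebra.Algebraic_Closure_Type"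
begin

section \<open>Multivariate and Laurent polynomials\<close>

text \<open>
  Polynomials in variables indexed by \<open>'v\<close> over \<open>'a\<close> form the monoid algebra of the monomials
  \<open>'v \<Rightarrow>\<^sub>0 nat\<close>; Laurent polynomials in one variable form the group algebra of the integers.
\<close>

type_synonym ('v, 'a) mpoly = "('v \<Rightarrow>\<^sub>0 nat) \<Rightarrow>\<^sub>0 'a"
type_synonym laurent = "int \<Rightarrow>\<^sub>0 complex"

definition Const :: "'a::comm_ring_1 \<Rightarrow> ('v, 'a) mpoly" where
  "Const c = Poly_Mapping.single 0 c"

definition Var :: "'v \<Rightarrow> ('v, 'a::comm_ring_1) mpoly" where
  "Var i = Poly_Mapping.single (Poly_Mapping.single i 1) 1"

definition mpoly_eval :: "('v, 'a::comm_ring_1) mpoly \<Rightarrow> ('v \<Rightarrow> 'a) \<Rightarrow> 'a" where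
  "mpoly_eval p x =
    (\<Sum>m\<in>Poly_Mapping.keys p. Poly_Mapping.lookup p m * (\<Prod>i\<in>Poly_Mapping.keys m. x i ^ Poly_Mapping.lookup m i))"

definition mpoly_pderiv :: "'v \<Rightarrow> ('v, 'a::comm_ring_1) mpoly \<Rightarrow> ('v, 'a) mpoly" where
  "mpoly_pderiv i p =
    (\<Sum>m\<in>Poly_Mapping.keys p. Poly_Mapping.single (m - Poly_Mapping.single i 1) (of_nat (Poly_Mapping.lookup m i) * Poly_Mapping.lookup p m))"

definition total_degree :: "('v, 'a::comm_ring_1) mpoly \<Rightarrow> nat" where
  "total_degree p = Max (insert 0 ((\<lambda>m. \<Sum>i\<in>Poly_Mapping.keys m. Poly_Mapping.lookup m i) ` Poly_Mapping.keys p))"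

definition laurent_const :: "complex \<Rightarrow> laurent" where
  "laurent_const c = Poly_Mapping.single 0 c"

definition laurent_var :: laurent where
  "laurent_var = Poly_Mapping.single 1 1"

definition laurent_eval :: "laurent \<Rightarrow> complex \<Rightarrow> complex" where
  "laurent_eval u z = (\<Sum>k\<in>Poly_Mapping.keys u. Poly_Mapping.lookup u k * z powi k)"


section \<open>The analytic data and the action of the multiplicative group\<close>

type_synonym datum = "(complex^2^2) \<times> complex"

definition top_infty :: "complex^2^2 \<Rightarrow> complex \<Rightarrow> complex^2^2" where
  "top_infty L e = L ** vector [vector [0, 1], vector [-1, -e]] ** matrix_inv L"

fun alpha :: "datum \<Rightarrow> complex" where
  "alpha (L, e) = top_infty L e $ 1 $ 1"

definition AnalyticData :: "datum set" where
  "AnalyticData = {p. det (fst p) = 1 \<and> alpha p \<noteq> 0}"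

text \<open>Weights \<open>-1\<close> on the first row of \<open>L\<close>, \<open>1\<close> on the second row and \<open>0\<close> on \<open>e\<close>.\<close>

fun Gm_act :: "complex \<Rightarrow> datum \<Rightarrow> datum" where
  "Gm_act \<mu> (L, e) =
    (vector [vector [\<mu> powi (-1) * L $ 1 $ 1, \<mu> powi (-1) * L $ 1 $ 2],
             vector [\<mu> * L $ 2 $ 1, \<mu> * L $ 2 $ 2]], e)"

datatype coord = L1 | L2 | L3 | L4 | E

fun coordinate :: "datum \<Rightarrow> coord \<Rightarrow> complex" where
  "coordinate (L, e) L1 = L $ 1 $ 1"
| "coordinate (L, e) L2 = L $ 1 $ 2"
| "coordinate (L, e) L3 = L $ 2 $ 1"
| "coordinate (L, e) L4 = L $ 2 $ 2"
| "coordinate (L, e) E = e"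

text \<open>
  On \<open>det L = 1\<close> the function \<open>alpha\<close> is polynomial in the coordinates (see \<open>alpha_polynomial\<close>
  below), so \<open>AnalyticData\<close> is the principal open subset \<open>alpha \<noteq> 0\<close> of the affine variety
  \<open>SL\<^sub>2 \<times> \<complex>\<close>. Hence its regular functions are the quotients of a polynomial in the coordinates
  by a power of \<open>alpha\<close>. They are taken extensional, so that equality of functions is equality
  on \<open>AnalyticData\<close>.
\<close>

definition regular_functions :: "(datum \<Rightarrow> complex) set" where
  "regular_functions = {f \<in> extensional AnalyticData.
    \<exists>(P :: (coord, complex) mpoly) n. \<forall>p\<in>AnalyticData.
      f p = mpoly_eval P (coordinate p) / alpha p ^ n}"


section \<open>The quotient, its morphism to the punctured line, and the fibres\<close>

text \<open>
  The affine schemes below are given by their coordinate rings: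
  \<open>\<R> = Spec (\<O>(AnalyticData)\<^sup>G)\<close> by the ring of invariants \<open>coord_ring_R\<close>, and \<open>\<P> = \<complex>\<^sup>*\<close> by the
  ring of Laurent polynomials.
\<close>

definition coord_ring_R :: "(datum \<Rightarrow> complex) ring" where
  "coord_ring_R =
    \<lparr>carrier = {f \<in> regular_functions. \<forall>\<mu>. \<mu> \<noteq> 0 \<longrightarrow> (\<forall>p\<in>AnalyticData. f (Gm_act \<mu> p) = f p)},
     mult = (\<lambda>f g. \<lambda>p\<in>AnalyticData. f p * g p),
     one = (\<lambda>p\<in>AnalyticData. 1),
     zero = (\<lambda>p\<in>AnalyticData. 0),
     add = (\<lambda>f g. \<lambda>p\<in>AnalyticData. f p + g p)\<rparr>"

text \<open>The comorphism \<open>\<O>(\<P>) \<rightarrow> \<O>(\<R>)\<close> of \<open>alpha\<close>.\<close>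

definition alpha_pullback :: "laurent \<Rightarrow> datum \<Rightarrow> complex" where
  "alpha_pullback u = (\<lambda>p\<in>AnalyticData. laurent_eval u (alpha p))"

text \<open>The index type \<open>3\<close> has the elements \<open>1\<close>, \<open>2\<close> and \<open>3 = 0\<close>.\<close>

definition x_fun :: "3 \<Rightarrow> datum \<Rightarrow> complex" where
  "x_fun i = (\<lambda>p\<in>AnalyticData.
    if i = 1 then coordinate p L1 * coordinate p L3
    else if i = 2 then coordinate p L2 * coordinate p L3
    else - coordinate p E)"

text \<open>
  The scheme-theoretic fibre over \<open>a\<close> is the base change along \<open>\<complex>[T, T\<^sup>-\<^sup>1] \<rightarrow> \<complex>\<close>, \<open>T \<mapsto> a\<close>,
  that is, \<open>\<O>(\<R>) / (\<alpha> - a)\<close>.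
\<close>

definition fibre_ideal :: "complex \<Rightarrow> (datum \<Rightarrow> complex) set" where
  "fibre_ideal a = PIdl\<^bsub>coord_ring_R\<^esub> (alpha_pullback (laurent_var - laurent_const a))"

definition fibre_ring :: "complex \<Rightarrow> (datum \<Rightarrow> complex) set ring" where
  "fibre_ring a = coord_ring_R Quot (fibre_ideal a)"

definition fibre_class ::
    "complex \<Rightarrow> (datum \<Rightarrow> complex) \<Rightarrow> (datum \<Rightarrow> complex) set" where
  "fibre_class a f = fibre_ideal a +>\<^bsub>coord_ring_R\<^esub> f"


section \<open>Cubic surfaces\<close>

definition cubic :: "'a::comm_ring_1 \<Rightarrow> (3, 'a) mpoly" where
  "cubic a = Var 1 * Var 2 * Var 3 + (Var 1)\<^sup>2 + (Var 2)\<^sup>2 + Const a * Var 1 + Var 2"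

text \<open>
  \<open>hypersurface_ring c x f S\<close>: the ring \<open>S\<close>, with structure map \<open>c\<close> from the coefficient ring, is
  the quotient of the polynomial ring by \<open>(f)\<close> as an algebra, the variables being mapped to \<open>x\<close>.
\<close>

definition hypersurface_ring ::
    "('a::comm_ring_1 \<Rightarrow> 'b) \<Rightarrow> ('v \<Rightarrow> 'b) \<Rightarrow> ('v, 'a) mpoly \<Rightarrow> 'b ring \<Rightarrow> bool" where
  "hypersurface_ring c x f S \<longleftrightarrow>
    (let A = (ring_of_type_algebra :: ('v, 'a) mpoly ring); I = PIdl\<^bsub>A\<^esub> f
     in \<exists>\<phi> \<in> ring_iso (A Quot I) S.
          (\<forall>a. \<phi> (I +>\<^bsub>A\<^esub> Const a) = c a) \<and> (\<forall>i. \<phi> (I +>\<^bsub>A\<^esub> Var i) = x i))"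

text \<open>
  The subscheme \<open>f = 0\<close> of affine space over the complex numbers is non-singular if the
  differential of \<open>f\<close> does not vanish at any of its points.
\<close>

definition nonsingular_hypersurface :: "('v, complex) mpoly \<Rightarrow> bool" where
  "nonsingular_hypersurface f \<longleftrightarrow>
    (\<forall>x. mpoly_eval f x = 0 \<longrightarrow> (\<exists>i. mpoly_eval (mpoly_pderiv i f) x \<noteq> 0))"


section \<open>Consistency of the definitions\<close>

lemma matrix_inv_SL2:
  fixes L :: "complex^2^2"
  assumes "det L = 1"
  shows "matrix_inv L = vector [vector [L$2$2, - L$1$2], vector [- L$2$1, L$1$1]]"
proof -
  let ?M = "vector [vector [L$2$2, - L$1$2], vector [- L$2$1, L$1$1]] :: complex^2^2"
  have d: "L$1$1 * L$2$2 - L$1$2 * L$2$1 = 1"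
    using assms by (simp add: det_2)
  have l: "L ** ?M = mat 1"
    using d by (simp add: vec_eq_iff matrix_matrix_mult_def forall_2 sum_2 mat_def algebra_simps)
  have r: "?M ** L = mat 1"
    using l matrix_left_right_inverse by blast
  have "L ** matrix_inv L = mat 1"
    unfolding matrix_inv_def using l r by (metis (mono_tags, lifting) someI_ex)
  then have "?M ** (L ** matrix_inv L) = ?M"
    by simp
  then show ?thesis
    using r by (simp add: matrix_mul_assoc)
qed

lemma alpha_polynomial:
  fixes L :: "complex^2^2"
  assumes "det L = 1"
  shows "alpha (L, e) = - L$1$2 * L$2$2 - L$1$1 * L$2$1 + e * L$1$2 * L$2$1"
  by (simp add: top_infty_def matrix_inv_SL2[OF assms] matrix_matrix_mult_def sum_2 algebra_simps)

lemma Gm_act_AnalyticData: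
  assumes "\<mu> \<noteq> 0" "p \<in> AnalyticData"
  shows "Gm_act \<mu> p \<in> AnalyticData" "alpha (Gm_act \<mu> p) = alpha p"
proof -
  obtain L e where p: "p = (L, e)" by fastforce
  have d: "det L = 1" using assms by (simp add: AnalyticData_def p)
  have d': "det (fst (Gm_act \<mu> p)) = 1"
    using d assms(1) by (simp add: p det_2 field_simps power_int_minus)
  show a: "alpha (Gm_act \<mu> p) = alpha p"
    using d d' assms(1) by (simp add: p alpha_polynomial del: alpha.simps)
      (simp add: field_simps power_int_minus)
  show "Gm_act \<mu> p \<in> AnalyticData"
    using d' a assms(2) by (simp add: AnalyticData_def)
qed

end

theory Submission
  imports Defs
begin

text \<open>
  An invariant regular function is, up to a power of \<open>\<alpha>\<close>, a combination of monomials of weight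
  zero, hence a polynomial in \<open>\<ell>\<^sub>i \<ell>\<^sub>j\<close> (\<open>i \<in> {1, 2}\<close>, \<open>j \<in> {3, 4}\<close>) and \<open>e\<close>. Here
  \<open>\<ell>\<^sub>1 \<ell>\<^sub>4 = 1 + x\<^sub>2\<close> and \<open>\<ell>\<^sub>2 \<ell>\<^sub>4 = - \<alpha> - x\<^sub>1 - x\<^sub>2 x\<^sub>3\<close>, and the relation
  \<open>(\<ell>\<^sub>1 \<ell>\<^sub>3) (\<ell>\<^sub>2 \<ell>\<^sub>4) = (\<ell>\<^sub>1 \<ell>\<^sub>4) (\<ell>\<^sub>2 \<ell>\<^sub>3)\<close> becomes the cubic. There are no further relations:
  the cubic is monic in \<open>x\<^sub>1\<close>, so a relation may be reduced to degree at most one in \<open>x\<^sub>1\<close>, and for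
  general \<open>\<alpha>, x\<^sub>2, x\<^sub>3\<close> the cubic has two distinct roots \<open>x\<^sub>1\<close>, both coming from points of the
  analytic data. The fibres follow by specialising \<open>\<alpha>\<close>.
\<close>

section \<open>Evaluation homomorphisms on monoid algebras\<close>

text \<open>Homomorphisms between whole types of type class \<open>comm_ring_1\<close>: calculations
  need no membership side conditions, and \<open>ring_hom\<close> enters only when quotients are
  formed.\<close>

locale unital_hom =
  fixes h :: "'a::comm_ring_1 \<Rightarrow> 'b::comm_ring_1"
  assumes one: "h 1 = 1"
    and add: "h (x + y) = h x + h y"
    and mult: "h (x * y) = h x * h y"
begin

lemma zero: "h 0 = 0"
  using add[of 0 0] by simp

lemma uminus: "h (- x) = - h x"
  using add[of x "- x"] zero by (simp add: eq_neg_iff_add_eq_0 add.commute)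

lemma diff: "h (x - y) = h x - h y"
  using add[of x "- y"] uminus by simp

lemma power: "h (x ^ n) = h x ^ n"
  by (induction n) (simp_all add: one mult)

lemmas hom_simps = zero one add mult uminus diff power

end

lemma unital_hom_id: "unital_hom (\<lambda>x. x)"
  by unfold_locales auto

lemma unital_hom_comp: "unital_hom f \<Longrightarrow> unital_hom g \<Longrightarrow> unital_hom (\<lambda>x. g (f x))"
  by (simp add: unital_hom_def)

text \<open>One construction covers both cases: with exponent vectors as the monoid it evaluates
  polynomials, with the integers it evaluates Laurent polynomials.\<close>

definition monoid_algebra_eval ::
    "('a::comm_ring_1 \<Rightarrow> 'b::comm_ring_1) \<Rightarrow> ('m \<Rightarrow> 'b) \<Rightarrow> ('m \<Rightarrow>\<^sub>0 'a) \<Rightarrow> 'b" where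
  "monoid_algebra_eval h \<psi> P =
    (\<Sum>m\<in>Poly_Mapping.keys P. h (Poly_Mapping.lookup P m) * \<psi> m)"

text \<open>Updating at a fresh key amounts to adding a single term. Additive properties therefore
  need checking on single terms only.\<close>

lemma poly_mapping_add_induct [case_names single add]:
  assumes "\<And>m c. Q (Poly_Mapping.single m c)"
    and "\<And>P R. Q P \<Longrightarrow> Q R \<Longrightarrow> Q (P + R)"
  shows "Q (P :: 'm \<Rightarrow>\<^sub>0 'a::comm_monoid_add)"
proof (induction P rule: Poly_Mapping.update_induct)
  case const
  show ?case using assms(1)[of undefined 0] by simp
next
  case (update f a b)
  have "Poly_Mapping.update a b f = Poly_Mapping.single a b + f"
    using update(1) by (intro poly_mapping_eqI)
      (auto simp: lookup_update lookup_add lookup_single when_def in_keys_iff)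
  then show ?case using assms update by simp
qed

lemma (in unital_hom) monoid_algebra_eval_superset:
  assumes "finite S" "Poly_Mapping.keys P \<subseteq> S"
  shows "monoid_algebra_eval h \<psi> P = (\<Sum>m\<in>S. h (Poly_Mapping.lookup P m) * \<psi> m)"
  unfolding monoid_algebra_eval_def using assms
  by (intro sum.mono_neutral_left) (auto simp: in_keys_iff zero)

lemma (in unital_hom) monoid_algebra_eval_single:
  "monoid_algebra_eval h \<psi> (Poly_Mapping.single m c) = h c * \<psi> m"
  by (subst monoid_algebra_eval_superset[of "{m}"]) auto

lemma (in unital_hom) monoid_algebra_eval_add:
  "monoid_algebra_eval h \<psi> (P + Q) = monoid_algebra_eval h \<psi> P + monoid_algebra_eval h \<psi> Q"
proof -
  let ?S = "Poly_Mapping.keys P \<union> Poly_Mapping.keys Q"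
  have "Poly_Mapping.keys (P + Q) \<subseteq> ?S"
    by (rule Poly_Mapping.keys_add)
  then show ?thesis
    by (simp add: monoid_algebra_eval_superset[of ?S] lookup_add add distrib_right sum.distrib)
qed

lemma unital_hom_monoid_algebra_eval:
  fixes \<psi> :: "'m::comm_monoid_add \<Rightarrow> 'b::comm_ring_1"
  assumes "unital_hom h" "\<psi> 0 = 1" and \<psi>: "\<And>m n. \<psi> (m + n) = \<psi> m * \<psi> n"
  shows "unital_hom (monoid_algebra_eval h \<psi>)"
proof -
  interpret unital_hom h by fact
  show ?thesis
  proof
    show "monoid_algebra_eval h \<psi> 1 = 1"
      using monoid_algebra_eval_single[of \<psi> 0 1] assms(2) by (simp add: one)
    show "monoid_algebra_eval h \<psi> (P + Q) = monoid_algebra_eval h \<psi> P + monoid_algebra_eval h \<psi> Q" for P Q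
      by (rule monoid_algebra_eval_add)
    show "monoid_algebra_eval h \<psi> (P * Q) = monoid_algebra_eval h \<psi> P * monoid_algebra_eval h \<psi> Q" for P Q
    \<comment> \<open>Both sides are additive in each factor, so two single terms suffice, and there
      the claim is multiplicativity of \<open>h\<close> and of \<psi>.\<close>
    proof (induction P rule: poly_mapping_add_induct)
      case (single m c)
      show ?case
      proof (induction Q rule: poly_mapping_add_induct)
        case (single n d)
        show ?case
          by (simp add: mult_single monoid_algebra_eval_single mult \<psi> ac_simps)
      qed (simp add: distrib_left monoid_algebra_eval_add)
    qed (simp add: distrib_right monoid_algebra_eval_add)
  qed
qed

section \<open>Evaluation and induction for polynomials and Laurent polynomials\<close>

definition monomial_value :: "('v \<Rightarrow> 'b::comm_ring_1) \<Rightarrow> ('v \<Rightarrow>\<^sub>0 nat) \<Rightarrow> 'b" where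
  "monomial_value x m = (\<Prod>i\<in>Poly_Mapping.keys m. x i ^ Poly_Mapping.lookup m i)"

lemma monomial_value_superset:
  assumes "finite S" "Poly_Mapping.keys m \<subseteq> S"
  shows "monomial_value x m = (\<Prod>i\<in>S. x i ^ Poly_Mapping.lookup m i)"
  unfolding monomial_value_def using assms
  by (intro prod.mono_neutral_left) (auto simp: in_keys_iff)

lemma monomial_value_0: "monomial_value x 0 = 1"
  by (simp add: monomial_value_def)

lemma monomial_value_single: "monomial_value x (Poly_Mapping.single i k) = x i ^ k"
  by (subst monomial_value_superset[of "{i}"]) auto

lemma monomial_value_add:
  "monomial_value x (m + n) = monomial_value x m * monomial_value x n"
proof -
  let ?S = "Poly_Mapping.keys m \<union> Poly_Mapping.keys n"
  have "Poly_Mapping.keys (m + n) \<subseteq> ?S"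
    by (rule Poly_Mapping.keys_add)
  then show ?thesis
    by (simp add: monomial_value_superset[of ?S] lookup_add power_add prod.distrib)
qed

definition mpoly_hom ::
    "('a::comm_ring_1 \<Rightarrow> 'b::comm_ring_1) \<Rightarrow> ('v \<Rightarrow> 'b) \<Rightarrow> ('v, 'a) mpoly \<Rightarrow> 'b" where
  "mpoly_hom h x = monoid_algebra_eval h (monomial_value x)"

lemma unital_hom_mpoly_hom: "unital_hom h \<Longrightarrow> unital_hom (mpoly_hom h x)"
  unfolding mpoly_hom_def
  by (rule unital_hom_monoid_algebra_eval) (simp_all add: monomial_value_0 monomial_value_add)

lemma mpoly_hom_Const: "unital_hom h \<Longrightarrow> mpoly_hom h x (Const c) = h c"
  by (simp add: mpoly_hom_def Const_def unital_hom.monoid_algebra_eval_single monomial_value_0)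

lemma mpoly_hom_Var: "unital_hom h \<Longrightarrow> mpoly_hom h x (Var i) = x i"
  by (simp add: mpoly_hom_def Var_def unital_hom.monoid_algebra_eval_single
      monomial_value_single unital_hom.one)

lemma mpoly_eval_eq_mpoly_hom: "mpoly_eval P x = mpoly_hom (\<lambda>c. c) x P"
  by (simp add: mpoly_eval_def mpoly_hom_def monoid_algebra_eval_def monomial_value_def)

lemma unital_hom_mpoly_eval: "unital_hom (\<lambda>P. mpoly_eval P x)"
  unfolding mpoly_eval_eq_mpoly_hom by (rule unital_hom_mpoly_hom[OF unital_hom_id])

lemma mpoly_eval_Const: "mpoly_eval (Const c) x = c"
  and mpoly_eval_Var: "mpoly_eval (Var i) x = x i"
  by (simp_all add: mpoly_eval_eq_mpoly_hom mpoly_hom_Const mpoly_hom_Var unital_hom_id)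

lemma unital_hom_Const: "unital_hom Const"
  by unfold_locales (simp_all add: Const_def single_add mult_single)

lemma unital_hom_laurent_const: "unital_hom laurent_const"
  by unfold_locales (simp_all add: laurent_const_def single_add mult_single)

lemma laurent_eval_eq: "laurent_eval u z = monoid_algebra_eval (\<lambda>c. c) (\<lambda>k. z powi k) u"
  by (simp add: laurent_eval_def monoid_algebra_eval_def)

lemma unital_hom_laurent_eval: "z \<noteq> 0 \<Longrightarrow> unital_hom (\<lambda>u. laurent_eval u z)"
  unfolding laurent_eval_eq
  by (rule unital_hom_monoid_algebra_eval[OF unital_hom_id]) (simp_all add: power_int_add)

lemma laurent_eval_single: "laurent_eval (Poly_Mapping.single k c) z = c * z powi k"
  by (simp add: laurent_eval_eq unital_hom.monoid_algebra_eval_single[OF unital_hom_id])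

lemma laurent_eval_const: "laurent_eval (laurent_const c) z = c"
  and laurent_eval_var: "laurent_eval laurent_var z = z"
  by (simp_all add: laurent_const_def laurent_var_def laurent_eval_single)

lemma mpoly_induct [case_names Const Var add]:
  assumes "\<And>c. Q (Const c)"
    and "\<And>P i. Q P \<Longrightarrow> Q (P * Var i)"
    and "\<And>P R. Q P \<Longrightarrow> Q R \<Longrightarrow> Q (P + R)"
  shows "Q (P :: ('v, 'a::comm_ring_1) mpoly)"
proof (induction P rule: poly_mapping_add_induct)
  case (single m c)
  \<comment> \<open>The exponent vector \<open>m\<close> is itself a finitely supported map, so the
    additive induction applies to it as well; \<open>P\<close> must stay arbitrary because a sum of
    exponents is absorbed in two stages.\<close>
  have *: "Q (P * Poly_Mapping.single m 1)" if "Q P" for P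
    using that
  proof (induction m arbitrary: P rule: poly_mapping_add_induct)
    case (single i k)
    then show ?case
    proof (induction k)
      case (Suc k)
      have "P * Poly_Mapping.single (Poly_Mapping.single i (Suc k)) 1 =
          P * Poly_Mapping.single (Poly_Mapping.single i k) 1 * Var i"
        using single_add[of i k "1::nat"] by (simp add: Var_def mult.assoc mult_single)
      then show ?case using Suc assms(2) by metis
    qed simp
  next
    case (add m n)
    have "P * Poly_Mapping.single (m + n) 1 = P * Poly_Mapping.single m 1 * Poly_Mapping.single n 1"
      by (simp add: mult.assoc mult_single)
    then show ?case using add by metis
  qed
  show ?case
    using *[OF assms(1)[of c]] by (simp add: Const_def mult_single)
qed (rule assms)

lemma laurent_induct [case_names const var inverse add]:
  assumes "\<And>c. Q (laurent_const c)"
    and "\<And>u. Q u \<Longrightarrow> Q (u * laurent_var)"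
    and "\<And>u. Q u \<Longrightarrow> Q (u * Poly_Mapping.single (-1) 1)"
    and "\<And>u v. Q u \<Longrightarrow> Q v \<Longrightarrow> Q (u + v)"
  shows "Q (u :: laurent)"
proof (induction u rule: poly_mapping_add_induct)
  case (single k c)
  show ?case
  proof (induction k rule: int_induct[where k = 0])
    case base
    then show ?case using assms(1) by (simp add: laurent_const_def)
  next
    case (step1 i)
    have "Poly_Mapping.single (i + 1) c = Poly_Mapping.single i c * laurent_var"
      by (simp add: laurent_var_def mult_single)
    then show ?case using step1 assms(2) by simp
  next
    case (step2 i)
    have "Poly_Mapping.single (i - 1) c = Poly_Mapping.single i c * Poly_Mapping.single (-1) 1"
      by (simp add: mult_single)
    then show ?case using step2 assms(3) by simp
  qed
qed (rule assms)

section \<open>Hypersurface rings\<close>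

lemma unital_hom_imp_ring_hom:
  assumes "unital_hom f"
  shows "f \<in> ring_hom ring_of_type_algebra ring_of_type_algebra"
proof -
  interpret unital_hom f by fact
  show ?thesis
    by (rule ring_hom_memI) (simp_all add: ring_of_type_algebra_def hom_simps)
qed

lemma PIdl_type_algebra: "PIdl\<^bsub>ring_of_type_algebra\<^esub> (f :: 'a::comm_ring_1) = {g. f dvd g}"
  by (auto simp: cgenideal_def ring_of_type_algebra_def dvd_def mult.commute)

text \<open>The first isomorphism theorem, with the additional information that the induced
  isomorphism has the prescribed values on constants and variables.\<close>

lemma hypersurface_ringI:
  fixes \<phi> :: "('v, 'a::comm_ring_1) mpoly \<Rightarrow> 'b"
  assumes S: "ring S" and hom: "\<phi> \<in> ring_hom ring_of_type_algebra S"
    and surj: "carrier S \<subseteq> range \<phi>"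
    and ker: "\<And>P. \<phi> P = \<zero>\<^bsub>S\<^esub> \<longleftrightarrow> f dvd P"
    and c: "\<And>a. \<phi> (Const a) = c a" and x: "\<And>i. \<phi> (Var i) = x i"
  shows "hypersurface_ring c x f S"
proof -
  let ?A = "ring_of_type_algebra :: ('v, 'a) mpoly ring"
  have car: "carrier ?A = UNIV"
    by (simp add: ring_of_type_algebra_def)
  interpret A: cring ?A
    by (rule cring_from_type_algebra)
  interpret S: ring S by fact
  interpret ring_hom_ring ?A S \<phi>
    by (rule ring_hom_ringI2) (use hom A.ring_axioms S in auto)
  have I: "a_kernel ?A S \<phi> = PIdl\<^bsub>?A\<^esub> f"
    unfolding a_kernel_def' car PIdl_type_algebra by (simp only: ker UNIV_I simp_thms)
  interpret I: ideal "PIdl\<^bsub>?A\<^esub> f" ?A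
    by (rule A.cgenideal_ideal) (simp add: car)
  have im: "\<phi> ` carrier ?A = carrier S"
    using surj hom_closed car by auto
  \<comment> \<open>The induced isomorphism sends a coset to the unique element of its image. The
    multiples of \<open>f\<close> are killed, so the image is a singleton.\<close>
  have val: "the_elem (\<phi> ` (PIdl\<^bsub>?A\<^esub> f +>\<^bsub>?A\<^esub> P)) = \<phi> P" for P
  proof -
    have eq: "\<phi> (Q + P) = \<phi> P" if "f dvd Q" for Q
    proof -
      have "\<phi> (Q \<oplus>\<^bsub>?A\<^esub> P) = \<phi> Q \<oplus>\<^bsub>S\<^esub> \<phi> P"
        by (rule hom_add) (simp_all add: car)
      moreover have "\<phi> Q = \<zero>\<^bsub>S\<^esub>"
        using that ker by simp
      moreover have "\<phi> P \<in> carrier S"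
        by (rule hom_closed) (simp add: car)
      ultimately show ?thesis
        by (simp add: ring_of_type_algebra_def)
    qed
    have "PIdl\<^bsub>?A\<^esub> f +>\<^bsub>?A\<^esub> P = (\<lambda>Q. Q + P) ` {Q. f dvd Q}"
      by (auto simp: a_r_coset_def' PIdl_type_algebra) (auto simp: ring_of_type_algebra_def)
    then have "\<phi> ` (PIdl\<^bsub>?A\<^esub> f +>\<^bsub>?A\<^esub> P) = {\<phi> P}"
      using eq dvd_0_right[of f] by (auto simp: image_image)
    then show ?thesis by simp
  qed
  show ?thesis
    unfolding hypersurface_ring_def Let_def
    using FactRing_iso_set[OF im] val c x unfolding I by (intro bexI) auto
qed

section \<open>The ring of invariants\<close>

text \<open>Evaluation at one fixed datum has values in the complex numbers, so it is a
  \<open>unital_hom\<close>; \<open>R_map\<close> then collects these values into an extensional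
  function on the data.\<close>

definition R_eval :: "datum \<Rightarrow> (3, laurent) mpoly \<Rightarrow> complex" where
  "R_eval p = mpoly_hom (\<lambda>u. laurent_eval u (alpha p)) (\<lambda>i. x_fun i p)"

definition R_map :: "(3, laurent) mpoly \<Rightarrow> datum \<Rightarrow> complex" where
  "R_map P = (\<lambda>p\<in>AnalyticData. R_eval p P)"

lemma alpha_nonzero: "p \<in> AnalyticData \<Longrightarrow> alpha p \<noteq> 0"
  by (simp add: AnalyticData_def)

lemma unital_hom_R_eval: "p \<in> AnalyticData \<Longrightarrow> unital_hom (R_eval p)"
  unfolding R_eval_def
  by (intro unital_hom_mpoly_hom unital_hom_laurent_eval alpha_nonzero)

lemma R_eval_Const: "p \<in> AnalyticData \<Longrightarrow> R_eval p (Const u) = laurent_eval u (alpha p)"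
  and R_eval_Var: "p \<in> AnalyticData \<Longrightarrow> R_eval p (Var i) = x_fun i p"
  by (simp_all add: R_eval_def mpoly_hom_Const mpoly_hom_Var unital_hom_laurent_eval alpha_nonzero)

lemma coordinate_relations:
  assumes "p \<in> AnalyticData"
  shows "coordinate p L1 * coordinate p L4 - coordinate p L2 * coordinate p L3 = 1"
    and "alpha p = - coordinate p L2 * coordinate p L4 - coordinate p L1 * coordinate p L3
      + coordinate p E * coordinate p L2 * coordinate p L3"
proof -
  obtain L e where p: "p = (L, e)" by fastforce
  have d: "det L = 1" using assms by (simp add: AnalyticData_def p)
  show "coordinate p L1 * coordinate p L4 - coordinate p L2 * coordinate p L3 = 1"
    using d by (simp add: p det_2)
  show "alpha p = - coordinate p L2 * coordinate p L4 - coordinate p L1 * coordinate p L3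
      + coordinate p E * coordinate p L2 * coordinate p L3"
    unfolding p alpha_polynomial[OF d] by simp
qed

lemma x_fun_values:
  assumes "p \<in> AnalyticData"
  shows "x_fun 1 p = coordinate p L1 * coordinate p L3"
    and "x_fun 2 p = coordinate p L2 * coordinate p L3"
    and "x_fun 3 p = - coordinate p E"
  using assms by (simp_all add: x_fun_def)

lemma R_eval_cubic:
  assumes "p \<in> AnalyticData"
  shows "R_eval p (cubic laurent_var) = 0"
proof -
  interpret unital_hom "R_eval p" by (rule unital_hom_R_eval[OF assms])
  define l1 l2 l3 l4 e where l: "l1 = coordinate p L1" "l2 = coordinate p L2"
    "l3 = coordinate p L3" "l4 = coordinate p L4" "e = coordinate p E"
  have d: "l1 * l4 - l2 * l3 = 1" and a: "alpha p = - l2 * l4 - l1 * l3 + e * l2 * l3"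
    using coordinate_relations[OF assms] by (simp_all add: l)
  \<comment> \<open>Substituting the formula for \<open>alpha\<close> cancels every term containing
    \<open>e\<close>, and what remains is a multiple of the determinant equation.\<close>
  have "R_eval p (cubic laurent_var) = - l2 * l3 * (l1 * l4 - l2 * l3 - 1)"
    unfolding cubic_def hom_simps R_eval_Const[OF assms] R_eval_Var[OF assms]
      x_fun_values[OF assms] laurent_eval_var a l[symmetric]
    by (simp add: algebra_simps power2_eq_square)
  then show ?thesis using d by simp
qed

text \<open>The condition of \<open>regular_functions\<close> freed from extensionality, so that
  sums and products may be written pointwise.\<close>

definition regular_expression :: "(datum \<Rightarrow> complex) \<Rightarrow> bool" where
  "regular_expression f \<longleftrightarrow> (\<exists>(P :: (coord, complex) mpoly) n. \<forall>p\<in>AnalyticData.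
      f p = mpoly_eval P (coordinate p) / alpha p ^ n)"

lemma regular_expression_cong:
  assumes "\<And>p. p \<in> AnalyticData \<Longrightarrow> f p = g p"
  shows "regular_expression f \<longleftrightarrow> regular_expression g"
  using assms by (simp add: regular_expression_def)

lemma regular_expression_const: "regular_expression (\<lambda>p. c)"
  unfolding regular_expression_def
  by (rule exI[of _ "Const c"], rule exI[of _ 0]) (simp add: mpoly_eval_Const)

lemma regular_expression_coordinate: "regular_expression (\<lambda>p. coordinate p i)"
  unfolding regular_expression_def
  by (rule exI[of _ "Var i"], rule exI[of _ 0]) (simp add: mpoly_eval_Var)

lemma regular_expression_mult:
  assumes "regular_expression f" "regular_expression g"
  shows "regular_expression (\<lambda>p. f p * g p)"
proof -
  obtain P m Q n where
    f: "\<And>p. p \<in> AnalyticData \<Longrightarrow> f p = mpoly_eval P (coordinate p) / alpha p ^ m" and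
    g: "\<And>p. p \<in> AnalyticData \<Longrightarrow> g p = mpoly_eval Q (coordinate p) / alpha p ^ n"
    using assms unfolding regular_expression_def by metis
  have "f p * g p = mpoly_eval (P * Q) (coordinate p) / alpha p ^ (m + n)"
    if "p \<in> AnalyticData" for p
    using that by (simp add: f g unital_hom.mult[OF unital_hom_mpoly_eval] power_add)
  then show ?thesis unfolding regular_expression_def by blast
qed

text \<open>A polynomial representing \<open>alpha\<close> where the determinant is 1. It keeps
  numerators polynomial when two fractions are brought to a common denominator.\<close>

definition alpha_mpoly :: "(coord, complex) mpoly" where
  "alpha_mpoly = - Var L2 * Var L4 - Var L1 * Var L3 + Var E * Var L2 * Var L3"

lemma mpoly_eval_alpha_mpoly:
  assumes "p \<in> AnalyticData"
  shows "mpoly_eval alpha_mpoly (coordinate p) = alpha p"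
proof -
  interpret unital_hom "\<lambda>P. mpoly_eval P (coordinate p)" by (rule unital_hom_mpoly_eval)
  show ?thesis
    by (simp add: alpha_mpoly_def coordinate_relations(2)[OF assms] hom_simps mpoly_eval_Var)
qed

lemma regular_expression_add:
  assumes "regular_expression f" "regular_expression g"
  shows "regular_expression (\<lambda>p. f p + g p)"
proof -
  obtain P m Q n where
    f: "\<And>p. p \<in> AnalyticData \<Longrightarrow> f p = mpoly_eval P (coordinate p) / alpha p ^ m" and
    g: "\<And>p. p \<in> AnalyticData \<Longrightarrow> g p = mpoly_eval Q (coordinate p) / alpha p ^ n"
    using assms unfolding regular_expression_def by metis
  have "f p + g p =
      mpoly_eval (P * alpha_mpoly ^ n + Q * alpha_mpoly ^ m) (coordinate p) / alpha p ^ (m + n)"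
    if "p \<in> AnalyticData" for p
  proof -
    interpret unital_hom "\<lambda>P. mpoly_eval P (coordinate p)" by (rule unital_hom_mpoly_eval)
    show ?thesis
      using alpha_nonzero[OF that]
      by (simp add: f[OF that] g[OF that] hom_simps mpoly_eval_alpha_mpoly[OF that] power_add
          add_frac_eq)
  qed
  then show ?thesis unfolding regular_expression_def by blast
qed

lemma regular_expression_alpha: "regular_expression alpha"
  unfolding regular_expression_def
  by (rule exI[of _ alpha_mpoly], rule exI[of _ 0]) (simp add: mpoly_eval_alpha_mpoly)

lemma regular_expression_inverse_alpha: "regular_expression (\<lambda>p. inverse (alpha p))"
  unfolding regular_expression_def
  by (rule exI[of _ "Const 1"], rule exI[of _ 1]) (simp add: mpoly_eval_Const field_simps)

lemma regular_expression_laurent: "regular_expression (\<lambda>p. laurent_eval u (alpha p))"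
proof (induction u rule: laurent_induct)
  case (const c)
  show ?case by (simp add: laurent_eval_const regular_expression_const)
next
  case (var u)
  have "regular_expression (\<lambda>p. laurent_eval u (alpha p) * alpha p)"
    by (rule regular_expression_mult[OF var regular_expression_alpha])
  then show ?case
    by (rule regular_expression_cong[THEN iffD1, rotated])
      (simp add: unital_hom.mult[OF unital_hom_laurent_eval] alpha_nonzero laurent_eval_var)
next
  case (inverse u)
  have "regular_expression (\<lambda>p. laurent_eval u (alpha p) * inverse (alpha p))"
    by (rule regular_expression_mult[OF inverse regular_expression_inverse_alpha])
  then show ?case
    by (rule regular_expression_cong[THEN iffD1, rotated])
      (simp add: unital_hom.mult[OF unital_hom_laurent_eval] alpha_nonzero laurent_eval_single
        power_int_minus)
next
  case (add u v)
  have "regular_expression (\<lambda>p. laurent_eval u (alpha p) + laurent_eval v (alpha p))"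
    by (rule regular_expression_add[OF add])
  then show ?case
    by (rule regular_expression_cong[THEN iffD1, rotated])
      (simp add: unital_hom.add[OF unital_hom_laurent_eval] alpha_nonzero)
qed

lemma regular_expression_x_fun: "regular_expression (x_fun i)"
proof -
  have "regular_expression (\<lambda>p. coordinate p L1 * coordinate p L3)"
    "regular_expression (\<lambda>p. coordinate p L2 * coordinate p L3)"
    "regular_expression (\<lambda>p. (-1) * coordinate p E)"
    by (intro regular_expression_mult regular_expression_coordinate regular_expression_const)+
  then have "regular_expression (x_fun 1)" "regular_expression (x_fun 2)"
    "regular_expression (x_fun 3)"
    using regular_expression_cong[OF x_fun_values(1)] regular_expression_cong[OF x_fun_values(2)]
      regular_expression_cong[OF x_fun_values(3)] by simp_all
  then show ?thesis using exhaust_3[of i] by auto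
qed

lemma regular_expression_R_eval: "regular_expression (\<lambda>p. R_eval p P)"
proof (induction P rule: mpoly_induct)
  case (Const u)
  show ?case
    using regular_expression_laurent[of u]
    by (rule regular_expression_cong[THEN iffD1, rotated]) (simp add: R_eval_Const)
next
  case (Var P i)
  have "regular_expression (\<lambda>p. R_eval p P * x_fun i p)"
    by (rule regular_expression_mult[OF Var regular_expression_x_fun])
  then show ?case
    by (rule regular_expression_cong[THEN iffD1, rotated])
      (simp add: unital_hom.mult[OF unital_hom_R_eval] R_eval_Var)
next
  case (add P Q)
  have "regular_expression (\<lambda>p. R_eval p P + R_eval p Q)"
    by (rule regular_expression_add[OF add])
  then show ?case
    by (rule regular_expression_cong[THEN iffD1, rotated])
      (simp add: unital_hom.add[OF unital_hom_R_eval])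
qed

section \<open>Invariance under the multiplicative group\<close>

lemma coordinate_Gm_act:
  "coordinate (Gm_act \<mu> p) L1 = \<mu> powi (-1) * coordinate p L1"
  "coordinate (Gm_act \<mu> p) L2 = \<mu> powi (-1) * coordinate p L2"
  "coordinate (Gm_act \<mu> p) L3 = \<mu> * coordinate p L3"
  "coordinate (Gm_act \<mu> p) L4 = \<mu> * coordinate p L4"
  "coordinate (Gm_act \<mu> p) E = coordinate p E"
  by (cases p; simp)+

lemma R_eval_Gm_act:
  assumes "\<mu> \<noteq> 0" "p \<in> AnalyticData"
  shows "R_eval (Gm_act \<mu> p) P = R_eval p P"
proof -
  note q = Gm_act_AnalyticData[OF assms]
  have "x_fun i (Gm_act \<mu> p) = x_fun i p" for i
    using q(1) assms by (simp add: x_fun_def coordinate_Gm_act power_int_minus)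
  then show ?thesis
    by (simp add: R_eval_def q(2))
qed

lemma R_map_in_carrier: "R_map P \<in> carrier coord_ring_R"
  using regular_expression_R_eval[of P]
  by (auto simp: coord_ring_R_def regular_functions_def R_map_def R_eval_Gm_act
      Gm_act_AnalyticData regular_expression_def)

text \<open>A Laurent polynomial in \<mu> that is constant on the punctured line equals its constant
  term: after multiplication by a power of \<mu> it becomes a polynomial identity with infinitely
  many solutions.\<close>

lemma sum_powi_eq_const_imp_weight_zero_sum:
  fixes a :: "'i \<Rightarrow> complex" and w :: "'i \<Rightarrow> int"
  assumes "finite S" and eq: "\<And>\<mu>. \<mu> \<noteq> 0 \<Longrightarrow> (\<Sum>m\<in>S. a m * \<mu> powi w m) = K"
  shows "(\<Sum>m | m \<in> S \<and> w m = 0. a m) = K"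
proof -
  \<comment> \<open>The sum of the absolute weights bounds each of them, so a factor
    \<open>\<mu> ^ N\<close> clears all negative exponents.\<close>
  define N where "N = (\<Sum>m\<in>S. nat \<bar>w m\<bar>)"
  have N: "w m + int N \<ge> 0" if "m \<in> S" for m
  proof -
    have "nat \<bar>w m\<bar> \<le> N"
      unfolding N_def using that \<open>finite S\<close> by (intro member_le_sum) auto
    then show ?thesis by linarith
  qed
  define Q where "Q = (\<Sum>m\<in>S. Polynomial.monom (a m) (nat (w m + int N))) - Polynomial.monom K N"
  have "poly Q \<mu> = 0" if "\<mu> \<noteq> 0" for \<mu>
  proof -
    have "a m * \<mu> ^ nat (w m + int N) = a m * \<mu> powi w m * \<mu> ^ N" if "m \<in> S" for m
    proof -
      have "\<mu> ^ nat (w m + int N) = \<mu> powi (w m + int N)"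
        using N[OF that] by (simp add: power_int_def)
      then show ?thesis
        using \<open>\<mu> \<noteq> 0\<close> by (simp add: power_int_add)
    qed
    then have "(\<Sum>m\<in>S. a m * \<mu> ^ nat (w m + int N)) = (\<Sum>m\<in>S. a m * \<mu> powi w m * \<mu> ^ N)"
      by (rule sum.cong[OF refl])
    then have "poly Q \<mu> = (\<Sum>m\<in>S. a m * \<mu> powi w m) * \<mu> ^ N - K * \<mu> ^ N"
      by (simp add: Q_def poly_sum poly_monom sum_distrib_right)
    then show ?thesis using eq[OF that] by simp
  qed
  then have "UNIV - {0} \<subseteq> {\<mu>. poly Q \<mu> = 0}" by auto
  moreover have "infinite (UNIV - {0 :: complex})"
    by (simp add: infinite_UNIV_char_0)
  ultimately have "Q = 0"
    using poly_roots_finite finite_subset by blast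
  \<comment> \<open>Degree \<open>N\<close> of the shifted polynomial corresponds to weight
    zero.\<close>
  then have "Polynomial.coeff Q N = 0" by simp
  then have "(\<Sum>m\<in>S. if nat (w m + int N) = N then a m else 0) = K"
    by (simp add: Q_def coeff_sum)
  moreover have "nat (w m + int N) = N \<longleftrightarrow> w m = 0" if "m \<in> S" for m
    using N[OF that] by auto
  ultimately show ?thesis
    using \<open>finite S\<close> by (simp add: sum.inter_filter cong: sum.cong)
qed

section \<open>Monomials of weight zero and surjectivity of the parametrisation\<close>

definition weight :: "(coord \<Rightarrow>\<^sub>0 nat) \<Rightarrow> int" where
  "weight m = int (Poly_Mapping.lookup m L3) + int (Poly_Mapping.lookup m L4)
    - int (Poly_Mapping.lookup m L1) - int (Poly_Mapping.lookup m L2)"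

lemma monomial_value_coordinate:
  "monomial_value x m = x L1 ^ Poly_Mapping.lookup m L1 * x L2 ^ Poly_Mapping.lookup m L2 *
    x L3 ^ Poly_Mapping.lookup m L3 * x L4 ^ Poly_Mapping.lookup m L4 *
    x E ^ Poly_Mapping.lookup m E"
proof -
  have "i \<in> {L1, L2, L3, L4, E}" for i
    by (cases i) auto
  then show ?thesis
    by (subst monomial_value_superset[of "{L1, L2, L3, L4, E}"]) (auto simp: mult.assoc)
qed

lemma monomial_value_Gm_act:
  assumes "\<mu> \<noteq> 0"
  shows "monomial_value (coordinate (Gm_act \<mu> p)) m =
    \<mu> powi weight m * monomial_value (coordinate p) m"
  using assms
  by (simp add: monomial_value_coordinate coordinate_Gm_act weight_def power_int_add power_int_diff
      power_mult_distrib power_int_minus field_simps)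

lemma weight_zero_product_eq_R_eval:
  assumes "a + b = c + d"
  shows "\<exists>Q. \<forall>p\<in>AnalyticData. coordinate p L1 ^ a * coordinate p L2 ^ b *
    coordinate p L3 ^ c * coordinate p L4 ^ d = R_eval p Q"
  using assms
proof (induction "a + b" arbitrary: a b c d)
  case 0
  then have "\<forall>p\<in>AnalyticData. coordinate p L1 ^ a * coordinate p L2 ^ b *
    coordinate p L3 ^ c * coordinate p L4 ^ d = R_eval p 1"
    by (simp add: unital_hom.one[OF unital_hom_R_eval])
  then show ?case by blast
next
  case (Suc k)
  \<comment> \<open>One factor of weight -1 is split off here and one of weight 1 next. Their
    product is one of four quadratic invariants, and the rest again has weight zero.\<close>
  obtain i a' b' where i: "(i = L1 \<and> a = Suc a' \<and> b = b') \<or> (i = L2 \<and> b = Suc b' \<and> a = a')"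
    using Suc.hyps(2) by (cases a; cases b) auto
  obtain j c' d' where j: "(j = L3 \<and> c = Suc c' \<and> d = d') \<or> (j = L4 \<and> d = Suc d' \<and> c = c')"
    using Suc.hyps(2) Suc.prems by (cases c; cases d) auto
  have "k = a' + b'" "a' + b' = c' + d'"
    using i j Suc.hyps(2) Suc.prems by auto
  then obtain Q where Q: "\<And>p. p \<in> AnalyticData \<Longrightarrow> coordinate p L1 ^ a' * coordinate p L2 ^ b' *
    coordinate p L3 ^ c' * coordinate p L4 ^ d' = R_eval p Q"
    using Suc.hyps(1) by blast
  have "\<exists>G. \<forall>p\<in>AnalyticData. coordinate p i * coordinate p j = R_eval p G"
  proof -
    let ?y = "- Const laurent_var - Var 1 - Var 2 * Var 3 :: (3, laurent) mpoly"
    have "coordinate p L1 * coordinate p L3 = R_eval p (Var 1) \<and>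
        coordinate p L1 * coordinate p L4 = R_eval p (1 + Var 2) \<and>
        coordinate p L2 * coordinate p L3 = R_eval p (Var 2) \<and>
        coordinate p L2 * coordinate p L4 = R_eval p ?y" if p: "p \<in> AnalyticData" for p
    proof -
      interpret unital_hom "R_eval p" by (rule unital_hom_R_eval[OF p])
      show ?thesis
        using coordinate_relations[OF p]
        by (simp add: hom_simps R_eval_Const R_eval_Var p x_fun_values laurent_eval_var
            algebra_simps)
    qed
    then show ?thesis using i j by metis
  qed
  then obtain G where G: "\<And>p. p \<in> AnalyticData \<Longrightarrow> coordinate p i * coordinate p j = R_eval p G"
    by blast
  have "coordinate p L1 ^ a * coordinate p L2 ^ b * coordinate p L3 ^ c * coordinate p L4 ^ d =
      R_eval p (Q * G)" if "p \<in> AnalyticData" for p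
  proof -
    have "coordinate p L1 ^ a * coordinate p L2 ^ b * coordinate p L3 ^ c * coordinate p L4 ^ d =
      (coordinate p L1 ^ a' * coordinate p L2 ^ b' * coordinate p L3 ^ c' * coordinate p L4 ^ d') *
      (coordinate p i * coordinate p j)"
      using i j by (auto simp: ac_simps)
    then show ?thesis
      using Q[OF that] G[OF that] by (simp add: unital_hom.mult[OF unital_hom_R_eval] that)
  qed
  then show ?case by blast
qed

lemma unital_hom_sum: "unital_hom h \<Longrightarrow> h (sum f S) = (\<Sum>i\<in>S. h (f i))"
  by (induction S rule: infinite_finite_induct)
    (simp_all add: unital_hom.zero unital_hom.add)

text \<open>Since \<open>alpha\<close> is invariant, the numerator of an invariant function is
  constant on orbits within the data. Its weight-zero part then has the same values there, which is
  averaging over the group in elementary form.\<close>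

lemma carrier_subset_range_R_map: "carrier coord_ring_R \<subseteq> range R_map"
proof
  fix f assume f: "f \<in> carrier coord_ring_R"
  then obtain P n where fP: "\<And>p. p \<in> AnalyticData \<Longrightarrow>
      f p = mpoly_eval P (coordinate p) / alpha p ^ n"
    by (auto simp: coord_ring_R_def regular_functions_def)
  have ext: "f \<in> extensional AnalyticData"
    and inv: "\<And>\<mu> p. \<mu> \<noteq> 0 \<Longrightarrow> p \<in> AnalyticData \<Longrightarrow> f (Gm_act \<mu> p) = f p"
    using f by (auto simp: coord_ring_R_def regular_functions_def)
  define S where "S = {m. m \<in> Poly_Mapping.keys P \<and> weight m = 0}"
  have val: "mpoly_eval P x = (\<Sum>m\<in>Poly_Mapping.keys P. Poly_Mapping.lookup P m * monomial_value x m)"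
    for x
    by (simp add: mpoly_eval_def monomial_value_def)
  have zero_part: "(\<Sum>m\<in>S. Poly_Mapping.lookup P m * monomial_value (coordinate p) m) =
      mpoly_eval P (coordinate p)" if p: "p \<in> AnalyticData" for p
    unfolding S_def
  proof (rule sum_powi_eq_const_imp_weight_zero_sum)
    fix \<mu> :: complex assume \<mu>: "\<mu> \<noteq> 0"
    have "mpoly_eval P (coordinate (Gm_act \<mu> p)) = mpoly_eval P (coordinate p)"
      using inv[OF \<mu> p] fP[OF p] fP[OF Gm_act_AnalyticData(1)[OF \<mu> p]] alpha_nonzero[OF p]
        Gm_act_AnalyticData(2)[OF \<mu> p] by simp
    then show "(\<Sum>m\<in>Poly_Mapping.keys P. Poly_Mapping.lookup P m *
        monomial_value (coordinate p) m * \<mu> powi weight m) = mpoly_eval P (coordinate p)"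
      by (simp add: val monomial_value_Gm_act[OF \<mu>] ac_simps)
  qed simp
  have "\<exists>Q. \<forall>p\<in>AnalyticData. monomial_value (coordinate p) m = R_eval p Q" if "m \<in> S" for m
  proof -
    have "Poly_Mapping.lookup m L1 + Poly_Mapping.lookup m L2 =
        Poly_Mapping.lookup m L3 + Poly_Mapping.lookup m L4"
      using that by (simp add: S_def weight_def)
    from weight_zero_product_eq_R_eval[OF this] obtain Q where
      Q: "\<And>p. p \<in> AnalyticData \<Longrightarrow> coordinate p L1 ^ Poly_Mapping.lookup m L1 *
        coordinate p L2 ^ Poly_Mapping.lookup m L2 * coordinate p L3 ^ Poly_Mapping.lookup m L3 *
        coordinate p L4 ^ Poly_Mapping.lookup m L4 = R_eval p Q" by blast
    \<comment> \<open>The sign appears because the third generator is \<open>-e\<close>.\<close>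
    have "monomial_value (coordinate p) m = R_eval p (Q * (- Var 3) ^ Poly_Mapping.lookup m E)"
      if p: "p \<in> AnalyticData" for p
    proof -
      interpret unital_hom "R_eval p" by (rule unital_hom_R_eval[OF p])
      show ?thesis
        by (simp add: monomial_value_coordinate Q[OF p] hom_simps R_eval_Var[OF p] x_fun_values[OF p])
    qed
    then show ?thesis by blast
  qed
  then obtain Q where Q: "\<And>m p. m \<in> S \<Longrightarrow> p \<in> AnalyticData \<Longrightarrow>
      monomial_value (coordinate p) m = R_eval p (Q m)"
    by metis
  \<comment> \<open>The last factor is the Laurent monomial of exponent \<open>-n\<close>, which
    accounts for the denominator \<open>alpha p ^ n\<close>.\<close>
  define T where "T = (\<Sum>m\<in>S. Const (laurent_const (Poly_Mapping.lookup P m)) * Q m) *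
    Const (Poly_Mapping.single (- int n) 1)"
  have "f p = R_eval p T" if p: "p \<in> AnalyticData" for p
  proof -
    interpret unital_hom "R_eval p" by (rule unital_hom_R_eval[OF p])
    have "R_eval p T = mpoly_eval P (coordinate p) / alpha p ^ n"
      unfolding zero_part[OF p, symmetric]
      by (simp add: T_def hom_simps unital_hom_sum[OF unital_hom_axioms] R_eval_Const[OF p]
          laurent_eval_const laurent_eval_single Q[OF _ p] power_int_minus divide_inverse)
    then show ?thesis using fP[OF p] by simp
  qed
  then have "f = R_map T"
    using ext by (auto simp: R_map_def extensional_def fun_eq_iff)
  then show "f \<in> range R_map" by blast
qed

section \<open>Ring structure of the invariants\<close>

lemma carrier_coord_ring_R: "carrier coord_ring_R = range R_map"
  using carrier_subset_range_R_map R_map_in_carrier by blast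

lemma coord_ring_R_ops:
  "\<one>\<^bsub>coord_ring_R\<^esub> = R_map 1"
  "\<zero>\<^bsub>coord_ring_R\<^esub> = R_map 0"
  "R_map P \<otimes>\<^bsub>coord_ring_R\<^esub> R_map Q = R_map (P * Q)"
  "R_map P \<oplus>\<^bsub>coord_ring_R\<^esub> R_map Q = R_map (P + Q)"
  by (auto simp: coord_ring_R_def R_map_def fun_eq_iff unital_hom.one[OF unital_hom_R_eval]
    unital_hom.zero[OF unital_hom_R_eval] unital_hom.add[OF unital_hom_R_eval]
    unital_hom.mult[OF unital_hom_R_eval])

lemma R_map_ring_hom: "R_map \<in> ring_hom ring_of_type_algebra coord_ring_R"
  by (rule ring_hom_memI) (simp_all add: R_map_in_carrier coord_ring_R_ops ring_of_type_algebra_def)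

text \<open>By surjectivity the invariants are the homomorphic image of a polynomial ring, so the
  ring axioms are inherited from there.\<close>

lemma cring_coord_ring_R: "cring coord_ring_R"
proof -
  have "ring (coord_ring_R \<lparr>carrier := R_map ` carrier ring_of_type_algebra,
      zero := R_map \<zero>\<^bsub>ring_of_type_algebra\<^esub>\<rparr>)"
    by (rule ring.ring_hom_imp_img_ring[OF ring_from_type_algebra R_map_ring_hom])
  moreover have "coord_ring_R \<lparr>carrier := R_map ` carrier ring_of_type_algebra,
      zero := R_map \<zero>\<^bsub>ring_of_type_algebra\<^esub>\<rparr> = coord_ring_R"
    using carrier_coord_ring_R coord_ring_R_ops(2)
    by (simp add: ring_of_type_algebra_def)
  ultimately interpret ring coord_ring_R
    by simp
  show ?thesis
    by unfold_locales (auto simp: carrier_coord_ring_R coord_ring_R_ops mult.commute)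
qed

lemma R_map_Const: "R_map (Const u) = alpha_pullback u"
  by (auto simp: R_map_def alpha_pullback_def R_eval_Const)

lemma R_map_Var: "R_map (Var i) = x_fun i"
  by (auto simp: R_map_def x_fun_def R_eval_Var)

section \<open>The kernel of the parametrisation\<close>

lemma unital_hom_poly_map_poly:
  assumes "unital_hom f"
  shows "unital_hom (\<lambda>p. poly (map_poly f p) x)"
proof -
  interpret unital_hom f by fact
  have add': "map_poly f (p + q) = map_poly f p + map_poly f q" for p q
    by (rule poly_eqI) (simp add: coeff_map_poly hom_simps)
  show ?thesis
  proof
    show "poly (map_poly f (p * q)) x = poly (map_poly f p) x * poly (map_poly f q) x" for p q
      by (induction p)
        (simp_all add: add' map_poly_smult map_poly_pCons hom_simps algebra_simps)
  qed (simp_all add: add' one)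
qed

lemma unital_hom_of_poly_map_poly:
  assumes "unital_hom f" "unital_hom g"
  shows "g (poly (map_poly f p) x) = poly (map_poly (\<lambda>c. g (f c)) p) (g x)"
proof -
  interpret f: unital_hom f by fact
  interpret g: unital_hom g by fact
  show ?thesis
    by (induction p) (simp_all add: map_poly_pCons f.zero g.hom_simps)
qed

text \<open>A polynomial in \<open>\<alpha>\<close> over polynomials in \<open>x\<^sub>2\<close> over polynomials in \<open>x\<^sub>3\<close>.\<close>

type_synonym poly3 = "complex poly poly poly"

text \<open>The arguments run from the innermost variable outwards: \<open>c\<close> is the value of
  \<open>x\<^sub>3\<close>, \<open>b\<close> that of \<open>x\<^sub>2\<close>, and \<open>t\<close>
  that of \<alpha>.\<close>

definition poly3_eval :: "complex \<Rightarrow> complex \<Rightarrow> complex \<Rightarrow> poly3 \<Rightarrow> complex" where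
  "poly3_eval c b t p = poly (map_poly (\<lambda>r. poly (map_poly (\<lambda>s. poly s c) r) b) p) t"

definition poly3_embed :: "poly3 \<Rightarrow> (3, laurent) mpoly" where
  "poly3_embed p = poly (map_poly (\<lambda>r. poly (map_poly (\<lambda>s. poly (map_poly
    (\<lambda>z. Const (laurent_const z)) s) (Var 3)) r) (Var 2)) p) (Const laurent_var)"

lemma unital_hom_Const_laurent_const: "unital_hom (\<lambda>z. Const (laurent_const z))"
  by (rule unital_hom_comp[OF unital_hom_laurent_const unital_hom_Const])

lemma unital_hom_poly3_embed: "unital_hom poly3_embed"
  unfolding poly3_embed_def
  by (intro unital_hom_poly_map_poly unital_hom_Const_laurent_const)

lemma poly3_embed_generators:
  "poly3_embed [:[:[:c:]:]:] = Const (laurent_const c)"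
  "poly3_embed [:0, 1:] = Const laurent_var"
  "poly3_embed [:[:0, 1:]:] = Var 2"
  "poly3_embed [:[:[:0, 1:]:]:] = Var 3"
proof -
  interpret k: unital_hom "\<lambda>z. Const (laurent_const z)" by (rule unital_hom_Const_laurent_const)
  interpret f: unital_hom "\<lambda>s. poly (map_poly (\<lambda>z. Const (laurent_const z)) s) x" for x
    by (intro unital_hom_poly_map_poly unital_hom_Const_laurent_const)
  interpret g: unital_hom "\<lambda>r. poly (map_poly (\<lambda>s. poly (map_poly
    (\<lambda>z. Const (laurent_const z)) s) x) r) y" for x y
    by (intro unital_hom_poly_map_poly unital_hom_Const_laurent_const)
  show "poly3_embed [:[:[:c:]:]:] = Const (laurent_const c)"
    "poly3_embed [:0, 1:] = Const laurent_var"
    "poly3_embed [:[:0, 1:]:] = Var 2"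
    "poly3_embed [:[:[:0, 1:]:]:] = Var 3"
    using k.one by (simp_all add: poly3_embed_def map_poly_pCons k.hom_simps f.hom_simps g.hom_simps)
qed

lemma R_eval_poly3_embed:
  assumes p: "p \<in> AnalyticData"
  shows "R_eval p (poly3_embed q) = poly3_eval (x_fun 3 p) (x_fun 2 p) (alpha p) q"
proof -
  note h = unital_hom_R_eval[OF p]
  have 1: "R_eval p (poly (map_poly (\<lambda>z. Const (laurent_const z)) s) (Var 3)) = poly s (x_fun 3 p)" for s
    by (subst unital_hom_of_poly_map_poly[OF _ h])
      (simp_all add: unital_hom_Const_laurent_const R_eval_Const R_eval_Var p laurent_eval_const)
  have 2: "R_eval p (poly (map_poly (\<lambda>s. poly (map_poly
    (\<lambda>z. Const (laurent_const z)) s) (Var 3)) r) (Var 2)) =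
    poly (map_poly (\<lambda>s. poly s (x_fun 3 p)) r) (x_fun 2 p)" for r
    by (subst unital_hom_of_poly_map_poly[OF _ h])
      (intro unital_hom_poly_map_poly unital_hom_Const_laurent_const, simp add: 1 R_eval_Var p)
  show ?thesis
    unfolding poly3_embed_def poly3_eval_def
    by (subst unital_hom_of_poly_map_poly[OF _ h])
      (intro unital_hom_poly_map_poly unital_hom_Const_laurent_const,
        simp add: 2 R_eval_Const p laurent_eval_var)
qed

lemma poly_eq_0_if_infinite_roots:
  fixes p :: "'a::idom poly"
  assumes "infinite S" "\<And>x. x \<in> S \<Longrightarrow> poly p x = 0"
  shows "p = 0"
  using assms poly_roots_finite[of p] finite_subset[of S "{x. poly p x = 0}"] by blast

text \<open>The variables are removed from the outside: infinitely many \<open>t\<close> kill the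
  coefficients in \<alpha>, the cofinitely many admissible \<open>b\<close> kill those in
  \<open>x\<^sub>2\<close>, and then all \<open>c\<close> are available. Note that \<open>B\<close>
  must not depend on \<open>c\<close>.\<close>

lemma poly3_eq_0I:
  assumes "finite B"
    and zero: "\<And>c b. b \<notin> B \<Longrightarrow> infinite {t. poly3_eval c b t p = 0}"
  shows "p = 0"
proof -
  have "poly (map_poly (\<lambda>s. poly s c) (Polynomial.coeff p i)) b = 0" if "b \<notin> B" for b c i
  proof -
    have "map_poly (\<lambda>r. poly (map_poly (\<lambda>s. poly s c) r) b) p = 0"
      using zero[OF that, of c] by (rule poly_eq_0_if_infinite_roots) (simp add: poly3_eval_def)
    then have "Polynomial.coeff (map_poly (\<lambda>r. poly (map_poly (\<lambda>s. poly s c) r) b) p) i = 0"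
      by simp
    then show ?thesis by (simp add: coeff_map_poly)
  qed
  moreover have "infinite (- B)"
    using \<open>finite B\<close> by (simp add: Compl_eq_Diff_UNIV infinite_UNIV_char_0)
  ultimately have "map_poly (\<lambda>s. poly s c) (Polynomial.coeff p i) = 0" for c i
    by (intro poly_eq_0_if_infinite_roots[of "- B"]) auto
  then have "Polynomial.coeff (map_poly (\<lambda>s. poly s c) (Polynomial.coeff p i)) j = 0" for c i j
    by simp
  then have "poly (Polynomial.coeff (Polynomial.coeff p i) j) c = 0" for c i j
    by (simp add: coeff_map_poly)
  then have "Polynomial.coeff (Polynomial.coeff p i) j = 0" for i j
    by (simp add: poly_all_0_iff_0[symmetric])
  then show ?thesis
    by (simp add: poly_eq_iff)
qed

lemma poly3_embed_clears_denominator: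
  "\<exists>n p. Const laurent_var ^ n * Const u = poly3_embed p"
proof -
  interpret c: unital_hom Const by (rule unital_hom_Const)
  interpret h: unital_hom poly3_embed by (rule unital_hom_poly3_embed)
  note gens = poly3_embed_generators
  let ?t = "[:0, 1:] :: poly3"
  show ?thesis
  proof (induction u rule: laurent_induct)
    case (const c)
    have "Const laurent_var ^ 0 * Const (laurent_const c) = poly3_embed [:[:[:c:]:]:]"
      by (simp add: gens)
    then show ?case by blast
  next
    case (var u)
    then obtain n p where "Const laurent_var ^ n * Const u = poly3_embed p" by blast
    then have "Const laurent_var ^ n * Const (u * laurent_var) = poly3_embed (p * ?t)"
      by (simp only: c.mult h.mult gens mult.assoc[symmetric])
    then show ?case by blast
  next
    case (inverse u)
    then obtain n p where eq: "Const laurent_var ^ n * Const u = poly3_embed p" by blast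
    have "laurent_var * Poly_Mapping.single (-1) 1 = (1 :: laurent)"
      by (simp add: laurent_var_def mult_single)
    then have "Const laurent_var * Const (Poly_Mapping.single (-1) 1 :: laurent) =
        (1 :: (3, laurent) mpoly)"
      by (simp only: c.mult[symmetric] c.one)
    then have "Const laurent_var ^ Suc n * Const (u * Poly_Mapping.single (-1) 1) =
        (Const laurent_var ^ n * Const u) * (1 :: (3, laurent) mpoly)"
      by (simp add: c.mult ac_simps)
    then show ?case using eq by (metis mult_1_right)
  next
    case (add u v)
    then obtain n p m q where eq: "Const laurent_var ^ n * Const u = poly3_embed p"
      "Const laurent_var ^ m * Const v = poly3_embed q" by blast
    have "Const laurent_var ^ (n + m) * Const (u + v) =
      Const laurent_var ^ m * (Const laurent_var ^ n * Const u) +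
      Const laurent_var ^ n * (Const laurent_var ^ m * Const v)"
      by (simp add: c.add power_add algebra_simps)
    also have "\<dots> = poly3_embed (?t ^ m * p + ?t ^ n * q)"
      by (simp only: eq h.hom_simps gens)
    finally show ?case by blast
  qed
qed

text \<open>Division with remainder by a polynomial that is monic and quadratic in
  \<open>x\<^sub>1\<close>. The power of \<alpha> makes the two coefficients of the remainder honest
  polynomials, to which root counting applies.\<close>

lemma normal_form_mod_cubic:
  "\<exists>n p q. cubic laurent_var dvd
    Const laurent_var ^ n * P - (poly3_embed p + poly3_embed q * Var 1)"
proof -
  interpret h: unital_hom poly3_embed by (rule unital_hom_poly3_embed)
  note gens = poly3_embed_generators
  let ?t = "[:0, 1:] :: poly3" and ?b = "[:[:0, 1:]:] :: poly3" and ?c = "[:[:[:0, 1:]:]:] :: poly3"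
  let ?T = "Const laurent_var :: (3, laurent) mpoly" and ?F = "cubic laurent_var"
  show ?thesis
  proof (induction P rule: mpoly_induct)
    case (Const u)
    obtain n p where "?T ^ n * Const u = poly3_embed p"
      using poly3_embed_clears_denominator by blast
    then have "?F dvd ?T ^ n * Const u - (poly3_embed p + poly3_embed 0 * Var 1)"
      by (simp add: h.zero)
    then show ?case by blast
  next
    case (Var P i)
    then obtain n p q where dvd: "?F dvd ?T ^ n * P - (poly3_embed p + poly3_embed q * Var 1)"
      by blast
    consider "i = 1" | "i = 2" | "i = 3" using exhaust_3[of i] by blast
    then show ?case
    proof cases
      case 1
      \<comment> \<open>Adding \<open>q\<close> times the cubic cancels the new square of
        \<open>x\<^sub>1\<close>, whose remaining terms are distributed over the two
        coefficients.\<close>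
      have "?F dvd (?T ^ n * P - (poly3_embed p + poly3_embed q * Var 1)) * Var 1 + ?F * poly3_embed q"
        by (rule dvd_add[OF dvd_mult2[OF dvd]]) simp
      also have "\<dots> = ?T ^ n * (P * Var i) -
          (poly3_embed (- q * (?b ^ 2 + ?b)) + poly3_embed (p - q * (?b * ?c + ?t)) * Var 1)"
        unfolding h.hom_simps gens cubic_def 1 by (simp add: algebra_simps power2_eq_square)
      finally show ?thesis by blast
    next
      case 2
      have "?F dvd (?T ^ n * P - (poly3_embed p + poly3_embed q * Var 1)) * Var 2"
        by (rule dvd_mult2[OF dvd])
      also have "\<dots> = ?T ^ n * (P * Var i) - (poly3_embed (p * ?b) + poly3_embed (q * ?b) * Var 1)"
        unfolding h.hom_simps gens 2 by (simp add: algebra_simps)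
      finally show ?thesis by blast
    next
      case 3
      have "?F dvd (?T ^ n * P - (poly3_embed p + poly3_embed q * Var 1)) * Var 3"
        by (rule dvd_mult2[OF dvd])
      also have "\<dots> = ?T ^ n * (P * Var i) - (poly3_embed (p * ?c) + poly3_embed (q * ?c) * Var 1)"
        unfolding h.hom_simps gens 3 by (simp add: algebra_simps)
      finally show ?thesis by blast
    qed
  next
    case (add P R)
    then obtain n p q m r s where dvd:
      "?F dvd ?T ^ n * P - (poly3_embed p + poly3_embed q * Var 1)"
      "?F dvd ?T ^ m * R - (poly3_embed r + poly3_embed s * Var 1)"
      by blast
    have "?F dvd ?T ^ m * (?T ^ n * P - (poly3_embed p + poly3_embed q * Var 1)) +
        ?T ^ n * (?T ^ m * R - (poly3_embed r + poly3_embed s * Var 1))"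
      by (intro dvd_add dvd_mult dvd)
    also have "\<dots> = ?T ^ (n + m) * (P + R) - (poly3_embed (?t ^ m * p + ?t ^ n * r) +
        poly3_embed (?t ^ m * q + ?t ^ n * s) * Var 1)"
      unfolding h.hom_simps gens by (simp add: power_add algebra_simps)
    finally show ?case by blast
  qed
qed

text \<open>The group action suggests the normalisation \<open>\<ell>\<^sub>3 = 1\<close>. Then
  \<open>\<ell>\<^sub>1 = x\<close> and \<open>\<ell>\<^sub>2 = b\<close>, the determinant forces
  \<open>\<ell>\<^sub>4 = (1 + b) / x\<close>, and the quadratic equation says exactly that
  \<open>alpha\<close> is \<open>t\<close>.\<close>

lemma AnalyticData_point:
  assumes "x \<noteq> 0" "t \<noteq> 0" and eq: "x\<^sup>2 + (b * c + t) * x + (b\<^sup>2 + b) = 0"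
  obtains p where "p \<in> AnalyticData" "alpha p = t"
    "x_fun 1 p = x" "x_fun 2 p = b" "x_fun 3 p = c"
proof -
  let ?L = "vector [vector [x, b], vector [1, (1 + b) / x]] :: complex^2^2"
  let ?p = "(?L, - c)"
  have d: "det ?L = 1"
    using \<open>x \<noteq> 0\<close> by (simp add: det_2)
  have "t * x = - (x\<^sup>2 + b * c * x + (b\<^sup>2 + b))"
    using eq by (simp add: algebra_simps eq_neg_iff_add_eq_0)
  also have "\<dots> = (- b * ((1 + b) / x) - x - c * b) * x"
    using \<open>x \<noteq> 0\<close> by (simp add: field_simps power2_eq_square)
  finally have a: "alpha ?p = t"
    unfolding alpha_polynomial[OF d] using \<open>x \<noteq> 0\<close> by simp
  then have p: "?p \<in> AnalyticData"
    using d \<open>t \<noteq> 0\<close> by (simp add: AnalyticData_def)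
  then show ?thesis
    using a by (intro that[of ?p]) (simp_all add: x_fun_values)
qed

lemma poly3_vanishing:
  assumes van_R: "\<And>d. d \<in> AnalyticData \<Longrightarrow>
    R_eval d (poly3_embed p + poly3_embed q * Var 1) = 0"
  shows "p = 0" "q = 0"
proof -
  have van: "poly3_eval c b t p = 0 \<and> poly3_eval c b t q = 0"
    if b: "b \<notin> {0, -1}" and t: "t \<noteq> 0" "(b * c + t)\<^sup>2 \<noteq> 4 * (b\<^sup>2 + b)" for b c t
  proof -
    \<comment> \<open>The cubic is \<open>x\<^sup>2 + k x + (b\<^sup>2 + b)\<close> in
      \<open>x\<close>, and \<open>r\<close> is a root of its discriminant. The condition on
      \<open>t\<close> makes the two solutions distinct; excluding 0 and -1 for \<open>b\<close>
      makes their product non-zero, as \<open>AnalyticData_point\<close> demands.\<close>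
    define k r where "k = b * c + t" and "r = csqrt (k\<^sup>2 - 4 * (b\<^sup>2 + b))"
    have r: "r\<^sup>2 = k\<^sup>2 - 4 * (b\<^sup>2 + b)" by (simp add: r_def)
    have "r \<noteq> 0" using t(2) by (simp add: r_def k_def)
    have b2: "b\<^sup>2 + b \<noteq> 0"
    proof -
      have "b\<^sup>2 + b = b * (b + 1)" by (simp add: algebra_simps power2_eq_square)
      then show ?thesis using b by (auto simp: eq_neg_iff_add_eq_0)
    qed
    have root: "poly3_eval c b t p + poly3_eval c b t q * x = 0"
      if x: "x\<^sup>2 + k * x + (b\<^sup>2 + b) = 0" for x
    proof -
      have "x \<noteq> 0" using x b2 by auto
      from AnalyticData_point[OF this t(1) x[unfolded k_def]] obtain d where
        d: "d \<in> AnalyticData" "alpha d = t" "x_fun 1 d = x" "x_fun 2 d = b" "x_fun 3 d = c"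
        by blast
      interpret unital_hom "R_eval d" by (rule unital_hom_R_eval[OF d(1)])
      show ?thesis
        using van_R[OF d(1)] by (simp add: hom_simps R_eval_poly3_embed R_eval_Var d)
    qed
    have quadratic: "((- k + s) / 2)\<^sup>2 + k * ((- k + s) / 2) + (b\<^sup>2 + b) = 0" if "s\<^sup>2 = r\<^sup>2" for s
    proof -
      have "((- k + s) / 2)\<^sup>2 + k * ((- k + s) / 2) = (s\<^sup>2 - k\<^sup>2) / 4"
        by (simp add: power2_eq_square field_simps)
      then show ?thesis using that r by simp
    qed
    let ?p = "poly3_eval c b t p" and ?q = "poly3_eval c b t q"
    have 1: "?p + ?q * ((- k + r) / 2) = 0" and 2: "?p + ?q * ((- k + - r) / 2) = 0"
      by (rule root[OF quadratic], simp)+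
    \<comment> \<open>A polynomial of degree at most one with two distinct zeros vanishes: the
      difference of its two values isolates the slope.\<close>
    have "?q * r = (?p + ?q * ((- k + r) / 2)) - (?p + ?q * ((- k + - r) / 2))"
      by (simp add: field_simps)
    then have "?q = 0"
      unfolding 1 2 using \<open>r \<noteq> 0\<close> by simp
    then show ?thesis using 1 by simp
  qed
  \<comment> \<open>For fixed \<open>b\<close> and \<open>c\<close> at most three values of
    \<open>t\<close> are lost: zero and the zeros of the discriminant.\<close>
  have inf: "infinite {t. t \<noteq> 0 \<and> (b * c + t)\<^sup>2 \<noteq> 4 * (b\<^sup>2 + b)}" for b c :: complex
  proof -
    define s where "s = csqrt (4 * (b\<^sup>2 + b))"
    have "(b * c + t)\<^sup>2 \<noteq> 4 * (b\<^sup>2 + b)" if "t \<noteq> s - b * c" "t \<noteq> - s - b * c" for t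
    proof
      assume "(b * c + t)\<^sup>2 = 4 * (b\<^sup>2 + b)"
      then have "(b * c + t)\<^sup>2 = s\<^sup>2" by (simp add: s_def)
      then have "b * c + t = s \<or> b * c + t = - s" by (simp add: power2_eq_iff)
      then show False using that by (metis add_diff_cancel_left')
    qed
    then have "- {0, s - b * c, - s - b * c} \<subseteq> {t. t \<noteq> 0 \<and> (b * c + t)\<^sup>2 \<noteq> 4 * (b\<^sup>2 + b)}"
      by blast
    moreover have "infinite (- {0, s - b * c, - s - b * c})"
      by (simp add: Compl_eq_Diff_UNIV infinite_UNIV_char_0)
    ultimately show ?thesis using finite_subset by blast
  qed
  have "infinite {t. poly3_eval c b t p = 0}" "infinite {t. poly3_eval c b t q = 0}"
    if "b \<notin> {0, -1}" for b c
    using van[OF that, of _ c] by (auto intro!: infinite_super[OF _ inf[of b c]])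
  then show "p = 0" "q = 0"
    by (auto intro!: poly3_eq_0I[of "{0, -1}"])
qed

lemma R_map_eq_0_iff: "R_map P = R_map 0 \<longleftrightarrow> cubic laurent_var dvd P"
proof
  assume "cubic laurent_var dvd P"
  then show "R_map P = R_map 0"
    by (auto simp: R_map_def fun_eq_iff R_eval_cubic dvd_def unital_hom.mult[OF unital_hom_R_eval]
        unital_hom.zero[OF unital_hom_R_eval])
next
  assume eq: "R_map P = R_map 0"
  have P: "R_eval d P = 0" if "d \<in> AnalyticData" for d
    using fun_cong[OF eq, of d] that by (simp add: R_map_def unital_hom.zero[OF unital_hom_R_eval])
  let ?T = "Const laurent_var :: (3, laurent) mpoly"
  obtain n p q where dvd: "cubic laurent_var dvd ?T ^ n * P - (poly3_embed p + poly3_embed q * Var 1)"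
    using normal_form_mod_cubic by blast
  have "R_eval d (poly3_embed p + poly3_embed q * Var 1) = 0" if d: "d \<in> AnalyticData" for d
  proof -
    interpret unital_hom "R_eval d" by (rule unital_hom_R_eval[OF d])
    have "R_eval d (?T ^ n * P - (poly3_embed p + poly3_embed q * Var 1)) = 0"
      using dvd by (auto simp: dvd_def mult R_eval_cubic[OF d])
    then show ?thesis by (simp add: diff mult P[OF d])
  qed
  from poly3_vanishing[OF this] have "cubic laurent_var dvd ?T ^ n * P"
    using dvd by (simp add: unital_hom.zero[OF unital_hom_poly3_embed])
  \<comment> \<open>The variable \<alpha> is a unit among Laurent polynomials, so the power
    introduced by the normal form cancels.\<close>
  then have "cubic laurent_var dvd Const (Poly_Mapping.single (-1) 1) ^ n * (?T ^ n * P)"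
    by (rule dvd_mult)
  also have "\<dots> = (Const (Poly_Mapping.single (-1) 1) * ?T) ^ n * P"
    by (simp add: power_mult_distrib)
  also have "Const (Poly_Mapping.single (-1) 1) * ?T = 1"
    by (simp add: laurent_var_def mult_single
        flip: unital_hom.mult[OF unital_hom_Const] unital_hom.one[OF unital_hom_Const])
  finally show "cubic laurent_var dvd P" by simp
qed

section \<open>The fibres\<close>

definition specialise :: "complex \<Rightarrow> (3, laurent) mpoly \<Rightarrow> (3, complex) mpoly" where
  "specialise a = mpoly_hom (\<lambda>u. Const (laurent_eval u a)) Var"

text \<open>A section of \<open>specialise a\<close> for non-zero \<open>a\<close>; it provides
  representatives of functions on a fibre whose coefficients do not involve \<alpha>.\<close>

definition constant_family :: "(3, complex) mpoly \<Rightarrow> (3, laurent) mpoly" where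
  "constant_family = mpoly_hom (\<lambda>c. Const (laurent_const c)) Var"

lemma unital_hom_constant_family: "unital_hom constant_family"
  unfolding constant_family_def by (rule unital_hom_mpoly_hom[OF unital_hom_Const_laurent_const])

lemma constant_family_Const: "constant_family (Const c) = Const (laurent_const c)"
  and constant_family_Var: "constant_family (Var i) = Var i"
  by (simp_all add: constant_family_def mpoly_hom_Const mpoly_hom_Var unital_hom_Const_laurent_const)

context
  fixes a :: complex
  assumes a: "a \<noteq> 0"
begin

lemma unital_hom_Const_laurent_eval: "unital_hom (\<lambda>u. Const (laurent_eval u a))"
  by (rule unital_hom_comp[OF unital_hom_laurent_eval[OF a] unital_hom_Const])

lemma unital_hom_specialise: "unital_hom (specialise a)"
  unfolding specialise_def by (rule unital_hom_mpoly_hom[OF unital_hom_Const_laurent_eval])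

lemma specialise_Const: "specialise a (Const u) = Const (laurent_eval u a)"
  and specialise_Var: "specialise a (Var i) = Var i"
  by (simp_all add: specialise_def mpoly_hom_Const mpoly_hom_Var unital_hom_Const_laurent_eval)

lemma specialise_constant_family: "specialise a (constant_family q) = q"
proof -
  interpret s: unital_hom "specialise a" by (rule unital_hom_specialise)
  interpret c: unital_hom constant_family by (rule unital_hom_constant_family)
  show ?thesis
    by (induction q rule: mpoly_induct)
      (simp_all add: s.hom_simps c.hom_simps specialise_Const specialise_Var constant_family_Const
        constant_family_Var laurent_eval_const)
qed

lemma laurent_remainder:
  "laurent_var - laurent_const a dvd u - laurent_const (laurent_eval u a)"
proof -
  interpret e: unital_hom "\<lambda>u. laurent_eval u a" by (rule unital_hom_laurent_eval[OF a])
  interpret k: unital_hom laurent_const by (rule unital_hom_laurent_const)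
  let ?d = "laurent_var - laurent_const a" and ?i = "Poly_Mapping.single (-1) 1 :: laurent"
  show ?thesis
  proof (induction u rule: laurent_induct)
    case (var u)
    have "?d dvd (u - laurent_const (laurent_eval u a)) * laurent_var +
        laurent_const (laurent_eval u a) * ?d"
      by (intro dvd_add dvd_mult2[OF var] dvd_triv_right)
    then show ?case
      by (simp add: e.hom_simps k.hom_simps laurent_eval_var algebra_simps)
  next
    case (inverse u)
    have i: "laurent_var * ?i = 1"
      by (simp add: laurent_var_def mult_single)
    have c: "laurent_const a * laurent_const (inverse a) = 1"
      by (simp add: a k.one flip: k.mult)
    \<comment> \<open>The second summand comes from
      \<open>1/T - 1/a = - (1/a) (1/T) (T - a)\<close>.\<close>
    have "?d dvd (u - laurent_const (laurent_eval u a)) * ?i -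
        laurent_const (laurent_eval u a) * laurent_const (inverse a) * ?i * ?d"
      by (intro dvd_diff dvd_mult2[OF inverse] dvd_triv_right)
    also have "\<dots> = u * ?i - laurent_const (laurent_eval u a) * laurent_const (inverse a)"
    proof -
      have "(u - k) * ?i - k * l * ?i * ?d =
          u * ?i - k * l * (laurent_var * ?i) + k * ?i * (laurent_const a * l - 1)" for k l
        by (simp add: algebra_simps)
      then show ?thesis by (simp only: i c) simp
    qed
    finally show ?case
      by (simp add: e.hom_simps k.hom_simps laurent_eval_single power_int_minus)
  next
    case (add u v)
    then show ?case
      using dvd_add[OF add] by (simp add: e.hom_simps k.hom_simps algebra_simps)
  qed (simp add: laurent_eval_const)
qed

lemma mpoly_remainder:
  "Const (laurent_var - laurent_const a) dvd P - constant_family (specialise a P)"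
proof -
  interpret s: unital_hom "specialise a" by (rule unital_hom_specialise)
  interpret c: unital_hom constant_family by (rule unital_hom_constant_family)
  interpret k: unital_hom "Const :: laurent \<Rightarrow> (3, laurent) mpoly" by (rule unital_hom_Const)
  show ?thesis
  proof (induction P rule: mpoly_induct)
    case (Const u)
    obtain v where "u - laurent_const (laurent_eval u a) = (laurent_var - laurent_const a) * v"
      using laurent_remainder by (auto simp: dvd_def)
    then have "Const u - Const (laurent_const (laurent_eval u a)) =
        (Const (laurent_var - laurent_const a) * Const v :: (3, laurent) mpoly)"
      by (simp only: k.mult[symmetric] k.diff[symmetric])
    then show ?case
      by (simp add: specialise_Const constant_family_Const)
  next
    case (Var P i)
    then show ?case
      using dvd_mult2[OF Var, of "Var i"]
      by (simp add: s.hom_simps c.hom_simps specialise_Var constant_family_Var algebra_simps)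
  next
    case (add P Q)
    then show ?case
      using dvd_add[OF add] by (simp add: s.hom_simps c.hom_simps algebra_simps)
  qed
qed

text \<open>Membership means lying in the ideal generated by the cubic and \<open>T - a\<close>.
  Modulo \<open>T - a\<close> a polynomial is the constant lift of its specialisation, so only the
  specialised cubic is left.\<close>

lemma R_map_mem_fibre_ideal_iff:
  "R_map P \<in> fibre_ideal a \<longleftrightarrow> cubic a dvd specialise a P"
proof -
  interpret s: unital_hom "specialise a" by (rule unital_hom_specialise)
  interpret c: unital_hom constant_family by (rule unital_hom_constant_family)
  interpret k: unital_hom "Const :: laurent \<Rightarrow> (3, laurent) mpoly" by (rule unital_hom_Const)
  let ?D = "Const (laurent_var - laurent_const a) :: (3, laurent) mpoly"
  have eq_iff: "R_map P = R_map Q \<longleftrightarrow> cubic laurent_var dvd P - Q" for P Q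
  proof -
    have "R_map P = R_map Q \<longleftrightarrow> R_map (P - Q) = R_map 0"
      by (auto simp: R_map_def fun_eq_iff unital_hom.diff[OF unital_hom_R_eval]
          unital_hom.zero[OF unital_hom_R_eval])
    then show ?thesis by (simp add: R_map_eq_0_iff)
  qed
  have "R_map P \<in> fibre_ideal a \<longleftrightarrow> (\<exists>G. R_map P = R_map (G * ?D))"
  proof -
    have "fibre_ideal a = {R_map G \<otimes>\<^bsub>coord_ring_R\<^esub> R_map ?D |G. True}"
      unfolding fibre_ideal_def cgenideal_def R_map_Const[symmetric] carrier_coord_ring_R by blast
    then show ?thesis by (auto simp: coord_ring_R_ops)
  qed
  also have "\<dots> \<longleftrightarrow> (\<exists>G. cubic laurent_var dvd P - G * ?D)"
    by (simp add: eq_iff)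
  also have "\<dots> \<longleftrightarrow> cubic a dvd specialise a P"
  proof
    assume "\<exists>G. cubic laurent_var dvd P - G * ?D"
    then obtain G r where "P - G * ?D = cubic laurent_var * r"
      by (auto simp: dvd_def)
    then have "specialise a (P - G * ?D) = specialise a (cubic laurent_var * r)"
      by simp
    moreover have "specialise a ?D = 0"
      by (simp add: specialise_Const unital_hom.diff[OF unital_hom_laurent_eval[OF a]]
          laurent_eval_var laurent_eval_const unital_hom.zero[OF unital_hom_Const])
    ultimately have "specialise a P = cubic a * specialise a r"
      by (simp add: s.hom_simps cubic_def specialise_Const specialise_Var laurent_eval_var)
    then show "cubic a dvd specialise a P" by simp
  next
    assume "cubic a dvd specialise a P"
    then obtain r where r: "specialise a P = cubic a * r"
      by (auto simp: dvd_def)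
    obtain G where G: "P - constant_family (specialise a P) = ?D * G"
      using mpoly_remainder by (auto simp: dvd_def)
    \<comment> \<open>The parameter occurs only in the term linear in \<open>x\<^sub>1\<close>, so
      lifting \<open>cubic a\<close> changes the universal cubic by
      \<open>(T - a) x\<^sub>1\<close>.\<close>
    have "constant_family (specialise a P) =
        (cubic laurent_var - ?D * Var 1) * constant_family r"
      unfolding r c.mult
      by (simp add: cubic_def c.hom_simps k.hom_simps constant_family_Const constant_family_Var
          algebra_simps)
    moreover have "P - ?D * G = constant_family (specialise a P)"
      unfolding G[symmetric] by simp
    ultimately have "P - ?D * G = (cubic laurent_var - ?D * Var 1) * constant_family r"
      by simp
    then have "P - (G - Var 1 * constant_family r) * ?D = cubic laurent_var * constant_family r"
      by (simp add: algebra_simps)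
    then show "\<exists>G. cubic laurent_var dvd P - G * ?D"
      by (metis dvd_triv_left)
  qed
  finally show ?thesis .
qed

lemma hypersurface_ring_fibre:
  "hypersurface_ring (\<lambda>c. fibre_class a (alpha_pullback (laurent_const c)))
    (\<lambda>i. fibre_class a (x_fun i)) (cubic a) (fibre_ring a)"
proof -
  let ?I = "fibre_ideal a" and ?R = coord_ring_R
  interpret R: cring ?R by (rule cring_coord_ring_R)
  interpret I: ideal ?I ?R
    unfolding fibre_ideal_def
    by (rule R.cgenideal_ideal) (simp add: R_map_in_carrier flip: R_map_Const)
  interpret c: unital_hom constant_family by (rule unital_hom_constant_family)
  have class_hom: "fibre_class a \<in> ring_hom ?R (fibre_ring a)"
    using I.rcos_ring_hom unfolding fibre_class_def fibre_ring_def by (simp add: fibre_class_def)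
  have zero: "\<zero>\<^bsub>fibre_ring a\<^esub> = ?I"
    by (simp add: fibre_ring_def FactRing_def)
  have class_zero_iff: "fibre_class a x = ?I \<longleftrightarrow> x \<in> ?I" if "x \<in> carrier ?R" for x
    using I.a_rcos_const I.rcos_const_imp_mem that by (auto simp: fibre_class_def)
  show ?thesis
  proof (rule hypersurface_ringI[where \<phi> = "\<lambda>q. fibre_class a (R_map (constant_family q))"])
    show "ring (fibre_ring a)"
      unfolding fibre_ring_def by (rule I.quotient_is_ring)
    show "(\<lambda>q. fibre_class a (R_map (constant_family q))) \<in> ring_hom ring_of_type_algebra (fibre_ring a)"
      using ring_hom_trans[OF ring_hom_trans[OF unital_hom_imp_ring_hom[OF unital_hom_constant_family]
          R_map_ring_hom] class_hom] by (simp add: comp_def)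
    show "carrier (fibre_ring a) \<subseteq> range (\<lambda>q. fibre_class a (R_map (constant_family q)))"
    proof
      fix C assume "C \<in> carrier (fibre_ring a)"
      then obtain P where C: "C = fibre_class a (R_map P)"
        by (auto simp: fibre_ring_def FactRing_def A_RCOSETS_def' fibre_class_def carrier_coord_ring_R)
      \<comment> \<open>\<open>P\<close> and this lift have the same specialisation, hence the same
        class on the fibre; constant lifts thus reach every class.\<close>
      let ?Q = "constant_family (specialise a P)"
      have mem: "R_map (P - ?Q) \<in> ?I"
        by (simp add: R_map_mem_fibre_ideal_iff unital_hom.diff[OF unital_hom_specialise]
            specialise_constant_family)
      have "R_map P = R_map (P - ?Q) \<oplus>\<^bsub>?R\<^esub> R_map ?Q"
        by (simp add: coord_ring_R_ops)
      then have "C = fibre_class a (R_map (P - ?Q)) \<oplus>\<^bsub>fibre_ring a\<^esub> fibre_class a (R_map ?Q)"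
        unfolding C using ring_hom_add[OF class_hom] R_map_in_carrier by metis
      also have "fibre_class a (R_map (P - ?Q)) = \<zero>\<^bsub>fibre_ring a\<^esub>"
        using mem class_zero_iff R_map_in_carrier zero by metis
      also have "\<zero>\<^bsub>fibre_ring a\<^esub> \<oplus>\<^bsub>fibre_ring a\<^esub> fibre_class a (R_map ?Q) = fibre_class a (R_map ?Q)"
      proof -
        interpret F: ring "fibre_ring a"
          unfolding fibre_ring_def by (rule I.quotient_is_ring)
        show ?thesis
          by (rule F.l_zero[OF ring_hom_closed[OF class_hom R_map_in_carrier]])
      qed
      finally show "C \<in> range (\<lambda>q. fibre_class a (R_map (constant_family q)))" by blast
    qed
    show "fibre_class a (R_map (constant_family P)) = \<zero>\<^bsub>fibre_ring a\<^esub> \<longleftrightarrow> cubic a dvd P" for P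
      by (simp add: zero class_zero_iff R_map_in_carrier R_map_mem_fibre_ideal_iff
          specialise_constant_family)
  qed (simp_all add: constant_family_Const constant_family_Var R_map_Const R_map_Var)
qed

end

section \<open>The cubic surfaces\<close>

text \<open>As a sum of single terms the cubic reveals its support, hence its degree, and can be
  differentiated term by term.\<close>

lemma cubic_eq_sum_singles:
  fixes a :: "'a::comm_ring_1"
  defines "e \<equiv> (\<lambda>i :: 3. Poly_Mapping.single i (1::nat))"
  shows "cubic a = Poly_Mapping.single (e 1 + e 2 + e 3) 1 + Poly_Mapping.single (e 1 + e 1) 1 +
    Poly_Mapping.single (e 2 + e 2) 1 + Poly_Mapping.single (e 1) a + Poly_Mapping.single (e 2) 1"
  by (simp add: cubic_def Var_def Const_def power2_eq_square mult_single e_def)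

lemma total_degree_cubic: "total_degree (cubic (a :: complex)) = 3"
proof -
  define e where "e i = Poly_Mapping.single i (1::nat)" for i :: 3
  define deg where "deg m = (\<Sum>i\<in>Poly_Mapping.keys m. Poly_Mapping.lookup m i)" for m :: "3 \<Rightarrow>\<^sub>0 nat"
  have deg: "deg m = (\<Sum>i\<in>UNIV. Poly_Mapping.lookup m i)" for m
    unfolding deg_def by (intro sum.mono_neutral_left) (auto simp: in_keys_iff)
  have deg_add: "deg (m + n) = deg m + deg n" for m n
    by (simp add: deg lookup_add sum.distrib)
  have deg_e: "deg (e i) = 1" for i
    by (simp add: deg_def e_def)
  note cubic = cubic_eq_sum_singles[of a, folded e_def]
  \<comment> \<open>The other monomials have degree 1 or 2, so nothing can cancel the one of degree
    3.\<close>
  have ne: "e 1 + e 1 \<noteq> e 1 + e 2 + e 3" "e 2 + e 2 \<noteq> e 1 + e 2 + e 3" "e 1 \<noteq> e 1 + e 2 + e 3"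
    "e 2 \<noteq> e 1 + e 2 + e 3"
    by (rule notI, drule arg_cong[of _ _ deg], simp add: deg_add deg_e)+
  have "Poly_Mapping.lookup (cubic a) (e 1 + e 2 + e 3) = 1"
  proof -
    have "Poly_Mapping.lookup (Poly_Mapping.single m 1 + Poly_Mapping.single k1 1 +
        Poly_Mapping.single k2 1 + Poly_Mapping.single k3 a + Poly_Mapping.single k4 1) m = 1"
      if "k1 \<noteq> m" "k2 \<noteq> m" "k3 \<noteq> m" "k4 \<noteq> m" for m k1 k2 k3 k4 :: "3 \<Rightarrow>\<^sub>0 nat"
      using that by (simp add: lookup_add lookup_single)
    from this[OF ne] show ?thesis unfolding cubic .
  qed
  then have "e 1 + e 2 + e 3 \<in> Poly_Mapping.keys (cubic a)"
    by (simp add: in_keys_iff)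
  moreover have "Poly_Mapping.keys (cubic a) \<subseteq> {e 1 + e 2 + e 3, e 1 + e 1, e 2 + e 2, e 1, e 2}"
  proof -
    have "Poly_Mapping.keys (Poly_Mapping.single k0 1 + Poly_Mapping.single k1 1 +
        Poly_Mapping.single k2 1 + Poly_Mapping.single k3 a + Poly_Mapping.single k4 1)
        \<subseteq> {k0, k1, k2, k3, k4}" for k0 k1 k2 k3 k4 :: "3 \<Rightarrow>\<^sub>0 nat"
      by (auto simp: in_keys_iff lookup_add lookup_single when_def split: if_splits)
    then show ?thesis unfolding cubic .
  qed
  then have "deg m \<le> 3" if "m \<in> Poly_Mapping.keys (cubic a)" for m
    using that by (auto simp: deg_add deg_e)
  moreover have "deg (e 1 + e 2 + e 3) = 3"
    by (simp add: deg_add deg_e)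
  ultimately show ?thesis
    unfolding total_degree_def deg_def[symmetric]
    by (intro Max_eqI) (auto intro: rev_image_eqI)
qed

section \<open>Partial derivatives and non-singularity\<close>

lemma mpoly_pderiv_superset:
  assumes "finite S" "Poly_Mapping.keys p \<subseteq> S"
  shows "mpoly_pderiv i p = (\<Sum>m\<in>S. Poly_Mapping.single (m - Poly_Mapping.single i 1)
    (of_nat (Poly_Mapping.lookup m i) * Poly_Mapping.lookup p m))"
  unfolding mpoly_pderiv_def using assms
  by (intro sum.mono_neutral_left) (auto simp: in_keys_iff)

lemma mpoly_pderiv_single:
  "mpoly_pderiv i (Poly_Mapping.single m c) =
    Poly_Mapping.single (m - Poly_Mapping.single i 1) (of_nat (Poly_Mapping.lookup m i) * c)"
  by (subst mpoly_pderiv_superset[of "{m}"]) auto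

lemma mpoly_pderiv_add: "mpoly_pderiv i (p + q) = mpoly_pderiv i p + mpoly_pderiv i q"
proof -
  let ?S = "Poly_Mapping.keys p \<union> Poly_Mapping.keys q"
  have "Poly_Mapping.keys (p + q) \<subseteq> ?S"
    by (rule Poly_Mapping.keys_add)
  then show ?thesis
    by (simp add: mpoly_pderiv_superset[of ?S] lookup_add distrib_left single_add sum.distrib)
qed

lemma mpoly_eval_single: "mpoly_eval (Poly_Mapping.single m c) x = c * monomial_value x m"
  by (simp add: mpoly_eval_eq_mpoly_hom mpoly_hom_def
      unital_hom.monoid_algebra_eval_single[OF unital_hom_id])

text \<open>At a singular point the third derivative gives \<open>x\<^sub>1 x\<^sub>2 = 0\<close>.
  On either branch the equation becomes a quadratic in the other variable with a double root,
  although its discriminant is 1 or \<open>a\<^sup>2\<close>.\<close>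

lemma nonsingular_cubic:
  assumes "a \<noteq> 0"
  shows "nonsingular_hypersurface (cubic a)"
  unfolding nonsingular_hypersurface_def
proof (intro allI impI)
  fix x :: "3 \<Rightarrow> complex"
  interpret unital_hom "\<lambda>P. mpoly_eval P x" by (rule unital_hom_mpoly_eval)
  assume "mpoly_eval (cubic a) x = 0"
  then have F: "x 1 * x 2 * x 3 + (x 1)\<^sup>2 + (x 2)\<^sup>2 + a * x 1 + x 2 = 0"
    by (simp add: cubic_def hom_simps mpoly_eval_Var mpoly_eval_Const)
  have mv: "monomial_value x m = x 1 ^ Poly_Mapping.lookup m 1 * x 2 ^ Poly_Mapping.lookup m 2 *
      x 3 ^ Poly_Mapping.lookup m 3" for m
  proof -
    have "(1 :: 3) \<notin> {2, 3}" "(2 :: 3) \<notin> {3}" by simp_all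
    moreover have "Poly_Mapping.keys m \<subseteq> {1, 2, 3}" using exhaust_3 by blast
    ultimately show ?thesis
      by (simp only: monomial_value_superset[of "{1, 2, 3}"] finite_insert finite.emptyI
          prod.insert prod.empty mult_1_right mult.assoc empty_iff not_False_eq_True)
  qed
  note simps = cubic_eq_sum_singles mpoly_pderiv_add mpoly_pderiv_single add one mpoly_eval_single
    mv lookup_minus lookup_add lookup_single when_def
  have d1: "mpoly_eval (mpoly_pderiv 1 (cubic a)) x = x 2 * x 3 + 2 * x 1 + a"
    by (simp add: simps)
  have d2: "mpoly_eval (mpoly_pderiv 2 (cubic a)) x = x 1 * x 3 + 2 * x 2 + 1"
    by (simp add: simps)
  have d3: "mpoly_eval (mpoly_pderiv 3 (cubic a)) x = x 1 * x 2"
    by (simp add: simps)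
  show "\<exists>i. mpoly_eval (mpoly_pderiv i (cubic a)) x \<noteq> 0"
  proof (rule ccontr)
    assume "\<nexists>i. mpoly_eval (mpoly_pderiv i (cubic a)) x \<noteq> 0"
    then have D: "x 2 * x 3 + 2 * x 1 + a = 0" "x 1 * x 3 + 2 * x 2 + 1 = 0" "x 1 * x 2 = 0"
      using d1 d2 d3 by metis+
    then consider "x 1 = 0" | "x 2 = 0" by auto
    then show False
    proof cases
      case 1
      then have "(x 2)\<^sup>2 + x 2 = 0" "2 * x 2 + 1 = 0" using F D by simp_all
      \<comment> \<open>For a monic quadratic \<open>f\<close> the discriminant equals
        \<open>f'\<^sup>2 - 4 f\<close>; the other branch uses the same identity.\<close>
      moreover have "1 = (2 * x 2 + 1)\<^sup>2 - 4 * ((x 2)\<^sup>2 + x 2)"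
        by (simp add: algebra_simps power2_eq_square)
      ultimately show False by simp
    next
      case 2
      then have "(x 1)\<^sup>2 + a * x 1 = 0" "2 * x 1 + a = 0" using F D by simp_all
      moreover have "a\<^sup>2 = (2 * x 1 + a)\<^sup>2 - 4 * ((x 1)\<^sup>2 + a * x 1)"
        by (simp add: algebra_simps power2_eq_square)
      ultimately show False using assms by simp
    qed
  qed
qed

theorem mainTheorem6:
  shows "hypersurface_ring alpha_pullback x_fun (cubic laurent_var) coord_ring_R \<and>
    (\<forall>a::complex. a \<noteq> 0 \<longrightarrow>
      hypersurface_ring (\<lambda>c. fibre_class a (alpha_pullback (laurent_const c)))
        (\<lambda>i. fibre_class a (x_fun i)) (cubic a) (fibre_ring a) \<and>
      total_degree (cubic a) = 3 \<and>
      nonsingular_hypersurface (cubic a))"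
proof (intro conjI allI impI)
  show "hypersurface_ring alpha_pullback x_fun (cubic laurent_var) coord_ring_R"
  proof (rule hypersurface_ringI[where \<phi> = R_map])
    show "ring coord_ring_R"
      using cring_coord_ring_R by (rule cring.axioms)
    show "R_map P = \<zero>\<^bsub>coord_ring_R\<^esub> \<longleftrightarrow> cubic laurent_var dvd P" for P
      by (simp add: coord_ring_R_ops R_map_eq_0_iff)
  qed (simp_all add: R_map_ring_hom carrier_coord_ring_R R_map_Const R_map_Var)
next
  fix a :: complex assume "a \<noteq> 0"
  then show "hypersurface_ring (\<lambda>c. fibre_class a (alpha_pullback (laurent_const c)))
        (\<lambda>i. fibre_class a (x_fun i)) (cubic a) (fibre_ring a)"
    by (rule hypersurface_ring_fibre)
  show "total_degree (cubic a) = 3"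
    by (rule total_degree_cubic)
  show "nonsingular_hypersurface (cubic a)"
    using \<open>a \<noteq> 0\<close> by (rule nonsingular_cubic)
qed

end
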